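(* (Further cubature formulas related to $\mathcal{P}^{III,-}_k$) Let $n$ be a positive integer. (1) For any integer $N>n$ and any polynomial $f\in\mathbb{R}[Y_1,\dots,Y_n]$ of degree at most $2(N-n)$, $$\int_{\mathfrak{F}}f(Y)\,\omega^{III,-}(Y)\,dY=\left(\frac{1}{N}\right)^n\sum_{Y\in \mathfrak{F}_N^{\mathrm{III},-}}\mathcal{E}_Y f(Y)\,\mathcal{J}^{III,-}(Y),$$ $$\int_{\mathfrak{F}}f(Y)\,\omega^{III,-}(Y)\,dY=\left(\frac{1}{N}\right)^n\sum_{Y\in \mathfrak{F}_N^{\mathrm{IV},-}}f(Y)\,\mathcal{J}^{III,-}(Y).$$ (2) For any integer $N>n$ and any polynomial $f\in\mathbb{R}[Y_1,\dots,Y_n]$ of degree at most $2(N-n)-1$, $$\int_{\mathfrak{F}}f(Y)\,\omega^{III,-}(Y)\,dY=\left(\frac{2}{2N-1}\right)^n\sum_{Y\in \mathfrak{F}_N^{\mathrm{VII},-}}\mathcal{E}_Y f(Y)\,\mathcal{J}^{III,-}(Y).$$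
   Context: For $\lambda,x\in\mathbb{R}^n$: $\cos^-_\lambda(x)=\sum_{\sigma\in S_n}\mathrm{sgn}(\sigma)\prod_{i=1}^n\cos(\pi\lambda_{\sigma(i)}x_i)$ and $\cos^+_\lambda(x)=\sum_{\sigma\in S_n}\prod_{i=1}^n\cos(\pi\lambda_{\sigma(i)}x_i)$. $F=\{x\in\mathbb{R}^n : 1\ge x_1\ge x_2\ge\dots\ge x_n\ge0\}$. Let $X_j(x)=\cos^+_{(1,\dots,1,0,\dots,0)}(x)$ with $j$ ones and $n-j$ zeros, $j=1,\dots,n$; let $\varphi(x)=(X_1(x),\dots,X_n(x))$ for $x\in F$ and $\mathfrak{F}=\varphi(F)$. The map $\varphi$ is injective on $F$. Let $J(x)=\det\frac{\partial(X_1,\dots,X_n)}{\partial(x_1,\dots,x_n)}$. Then $J(x)^2=p^{I,+}(\varphi(x))$ for a polynomial $p^{I,+}$; put $\mathcal{J}(Y)=\sqrt{p^{I,+}(Y)}$ for $Y\in\mathfrak{F}$ (so $\mathcal{J}(\varphi(x))=|J(x)|$ for $x\in F$). With $\rho_2=(n-\frac12,n-\frac32,\dots,\frac12)$, the polynomial $\mathcal{J}^{III,-}$ is determined by $\mathcal{J}^{III,-}(\varphi(x))=\cos^-_{\rho_2}(x)^2$, and $\omega^{III,-}=\mathcal{J}^{III,-}/\mathcal{J}$. For fixed $N$: $c_r=\frac12$ if $r=0$ or $r=N$, and $c_r=1$ otherwise; $D_N^-=\{r\in\mathbb{Z}^n : N-1\ge r_1>\dots>r_n\ge0\}$. Grids: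 $F_N^{\mathrm{III},-}=\left\{\left(\frac{r_1}{N},\dots,\frac{r_n}{N}\right): r\in D_{N}^-\right\}$, $F_N^{\mathrm{IV},-}=\left\{\left(\frac{r_1+\frac12}{N},\dots,\frac{r_n+\frac12}{N}\right): r\in D_{N}^-\right\}$, $F_N^{\mathrm{VII},-}=\left\{\left(\frac{2r_1}{2N-1},\dots,\frac{2r_n}{2N-1}\right): r\in D_{N}^-\right\}$, and $\mathfrak{F}_N^{t,-}=\varphi(F_N^{t,-})$. For $Y=\varphi(s)$ with $s$ the grid point labeled by $r$: $\mathcal{E}_Y=c_{r_1}\cdots c_{r_n}$ (grids III and VII). *)

theory Defs
  imports "HOL-Analysis.Analysis" "HOL-Library.Poly_Mapping"
begin

text \<open>
  The index set $\{1, \dots, n\}$ is rendered by a finite well-ordered type \<open>'n\<close>: \<open>n = CARD('n)\<close>, and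
  the \<open>k\<close>-th smallest element of \<open>'n\<close> plays the role of the index \<open>k\<close>.
\<close>

definition pos :: "'n::{finite,wellorder} \<Rightarrow> nat" where
  "pos i = card {j. j \<le> i}"


subsection \<open>Real polynomials in the variables indexed by \<open>'n\<close>\<close>

text \<open>A polynomial is a finitely supported map from exponent vectors to coefficients.\<close>

type_synonym 'n rpoly = "('n \<Rightarrow>\<^sub>0 nat) \<Rightarrow>\<^sub>0 real"

definition rpoly_eval :: "'n::finite rpoly \<Rightarrow> real^'n \<Rightarrow> real" where
  "rpoly_eval p Y =
     (\<Sum>m\<in>Poly_Mapping.keys p. Poly_Mapping.lookup p m * (\<Prod>i\<in>UNIV. (Y $ i) ^ Poly_Mapping.lookup m i))"

text \<open>Total degree; the zero polynomial gets degree 0, so it satisfies every degree bound.\<close>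

definition rpoly_degree :: "'n::finite rpoly \<Rightarrow> nat" where
  "rpoly_degree p = Max (insert 0 ((\<lambda>m. \<Sum>i\<in>UNIV. Poly_Mapping.lookup m i) ` Poly_Mapping.keys p))"


subsection \<open>(Anti)symmetric cosine functions and the coordinates \<open>X\<^sub>1, \<dots>, X\<^sub>n\<close>\<close>

definition cos_minus :: "real^'n::finite \<Rightarrow> real^'n \<Rightarrow> real" where
  "cos_minus l x =
     (\<Sum>\<sigma> | \<sigma> permutes UNIV. of_int (sign \<sigma>) * (\<Prod>i\<in>UNIV. cos (pi * l $ \<sigma> i * x $ i)))"

definition cos_plus :: "real^'n::finite \<Rightarrow> real^'n \<Rightarrow> real" where
  "cos_plus l x =
     (\<Sum>\<sigma> | \<sigma> permutes UNIV. \<Prod>i\<in>UNIV. cos (pi * l $ \<sigma> i * x $ i))"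

definition fund_dom :: "(real^'n::{finite,wellorder}) set" where
  "fund_dom = {x. (\<forall>i. 0 \<le> x $ i \<and> x $ i \<le> 1) \<and> (\<forall>i j. i \<le> j \<longrightarrow> x $ j \<le> x $ i)}"

definition Xfun :: "'n::{finite,wellorder} \<Rightarrow> real^'n::_ \<Rightarrow> real" where
  "Xfun j = cos_plus (\<chi> k. if k \<le> j then 1 else 0)"

definition phi :: "real^'n::{finite,wellorder} \<Rightarrow> real^'n::_" where
  "phi x = (\<chi> j. Xfun j x)"

definition frakF :: "(real^'n::{finite,wellorder}) set" where
  "frakF = phi ` fund_dom"


subsection \<open>The weight function\<close>

definition Jac :: "real^'n::{finite,wellorder} \<Rightarrow> real" where
  "Jac x = det (jacobian phi (at x))"

text \<open>
  The two polynomials below are pinned down by their values along \<open>phi\<close>, whose image has non-empty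
  interior; in any case only their values on \<open>frakF\<close> are used.
\<close>

definition pI_plus :: "'n::{finite,wellorder} rpoly" where
  "pI_plus = (SOME p. \<forall>x. rpoly_eval p (phi x) = (Jac x)\<^sup>2)"

definition calJ :: "real^'n::{finite,wellorder} \<Rightarrow> real" where
  "calJ Y = sqrt (rpoly_eval pI_plus Y)"

definition rho2 :: "real^'n::{finite,wellorder}" where
  "rho2 = (\<chi> i. real CARD('n) - real (pos i) + 1 / 2)"

definition calJ_III_minus :: "'n::{finite,wellorder} rpoly" where
  "calJ_III_minus = (SOME p. \<forall>x. rpoly_eval p (phi x) = (cos_minus rho2 x)\<^sup>2)"

definition omega_III_minus :: "real^'n::{finite,wellorder} \<Rightarrow> real" where
  "omega_III_minus Y = rpoly_eval calJ_III_minus Y / calJ Y"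


subsection \<open>Grids and nodes\<close>

definition D_minus :: "nat \<Rightarrow> (int^'n::{finite,wellorder}) set" where
  "D_minus N = {r. (\<forall>i. 0 \<le> r $ i \<and> r $ i \<le> int N - 1) \<and> (\<forall>i j. i < j \<longrightarrow> r $ j < r $ i)}"

definition pt_III :: "nat \<Rightarrow> int^'n::_ \<Rightarrow> real^'n::{finite,wellorder}" where
  "pt_III N r = (\<chi> i. real_of_int (r $ i) / real N)"

definition pt_IV :: "nat \<Rightarrow> int^'n::_ \<Rightarrow> real^'n::{finite,wellorder}" where
  "pt_IV N r = (\<chi> i. (real_of_int (r $ i) + 1 / 2) / real N)"

definition pt_VII :: "nat \<Rightarrow> int^'n::_ \<Rightarrow> real^'n::{finite,wellorder}" where
  "pt_VII N r = (\<chi> i. 2 * real_of_int (r $ i) / (2 * real N - 1))"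

definition F_III_minus :: "nat \<Rightarrow> (real^'n::{finite,wellorder}) set" where
  "F_III_minus N = pt_III N ` D_minus N"

definition F_IV_minus :: "nat \<Rightarrow> (real^'n::{finite,wellorder}) set" where
  "F_IV_minus N = pt_IV N ` D_minus N"

definition F_VII_minus :: "nat \<Rightarrow> (real^'n::{finite,wellorder}) set" where
  "F_VII_minus N = pt_VII N ` D_minus N"

definition frakF_III_minus :: "nat \<Rightarrow> (real^'n::{finite,wellorder}) set" where
  "frakF_III_minus N = phi ` F_III_minus N"

definition frakF_IV_minus :: "nat \<Rightarrow> (real^'n::{finite,wellorder}) set" where
  "frakF_IV_minus N = phi ` F_IV_minus N"

definition frakF_VII_minus :: "nat \<Rightarrow> (real^'n::{finite,wellorder}) set" where
  "frakF_VII_minus N = phi ` F_VII_minus N"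

definition cfac :: "nat \<Rightarrow> int \<Rightarrow> real" where
  "cfac N r = (if r = 0 \<or> r = int N then 1 / 2 else 1)"

text \<open>
  The weight of a node \<open>Y\<close> is read off from its label, the \<open>r\<close> with \<open>Y = phi s\<close> for the grid point
  \<open>s\<close> labelled by \<open>r\<close>; the label is unique because \<open>phi\<close> is injective on \<open>fund_dom\<close>.
\<close>

definition calE_III :: "nat \<Rightarrow> real^'n::{finite,wellorder} \<Rightarrow> real" where
  "calE_III N Y =
     (let r = (THE r. r \<in> D_minus N \<and> phi (pt_III N r) = Y) in \<Prod>i\<in>UNIV. cfac N (r $ i))"

definition calE_VII :: "nat \<Rightarrow> real^'n::{finite,wellorder} \<Rightarrow> real" where
  "calE_VII N Y =
     (let r = (THE r. r \<in> D_minus N \<and> phi (pt_VII N r) = Y) in \<Prod>i\<in>UNIV. cfac N (r $ i))"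

end

theory Submission
  imports Defs
begin

text \<open>
  All three formulas are the same statement about a trigonometric polynomial, read through the
  substitution \<open>Y = phi x\<close>. In the variables \<open>c\<^sub>i = cos (pi x\<^sub>i)\<close> the coordinate \<open>X\<^sub>j\<close> is a positive
  multiple of the elementary symmetric function \<open>e\<^sub>j\<close> (\<open>Xfun_elem_sym\<close>). Hence \<open>phi\<close> is injective on
  \<open>fund_dom\<close>: the \<open>e\<^sub>j\<close> determine the multiset of the \<open>c\<^sub>i\<close>, and on \<open>fund_dom\<close> they come sorted
  (\<open>inj_on_phi\<close>). On \<open>fund_dom\<close> the Jacobian vanishes only where two coordinates coincide or one of
  them is 0 or 1 (\<open>Jac_nonzero\<close>). The weight is the quotient of \<open>(cos_minus rho2)\<^sup>2\<close> by \<open>\<bar>Jac\<bar>\<close>, so the change of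
  variables cancels the Jacobian and the integral becomes that of
  \<open>pullback f = (f \<circ> phi) * (cos_minus rho2)\<^sup>2\<close> over \<open>fund_dom\<close> (\<open>integral_weighted\<close>).

  The polynomials \<open>pI_plus\<close> and \<open>calJ_III_minus\<close> are picked by a choice operator, so their existence
  has to be shown. Both \<open>Jac\<close> and \<open>cos_minus rho2\<close> are determinants of matrices \<open>A\<close> of which one
  index is that of the variables \<open>x\<^sub>i\<close>; the square is the determinant of the Gram matrix of \<open>A\<close> that
  sums over this index. Its entries are sums over \<open>i\<close> of a polynomial in \<open>c\<^sub>i\<close> (with coefficients
  polynomial in the \<open>e\<^sub>m\<close>), hence combinations of power sums, and Newton's identities express those
  through the \<open>e\<^sub>m\<close>.

  The function \<open>pullback f\<close> is symmetric in the variables, so its integral over \<open>fund_dom\<close> is \<open>1 / n!\<close>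
  times the integral over the cube (\<open>integral_cube_fund_dom\<close>). It is a polynomial in the \<open>c\<^sub>i\<close> of
  degree at most \<open>deg f + 2 n - 1\<close> in each of them, because every \<open>X\<^sub>j\<close> has degree 1 in each \<open>c\<^sub>i\<close> and
  the largest entry of \<open>rho2\<close> is \<open>n - 1 / 2\<close>. This is at most \<open>2 N - 1\<close> for the first two formulas and at
  most \<open>2 N - 2\<close> for the third, which are the degrees up to which the trapezoidal rule, the midpoint
  rule and the trapezoidal rule on the circle with \<open>2 N - 1\<close> points are exact. Their tensor powers
  integrate \<open>pullback f\<close> over the cube exactly, and because \<open>cos_minus rho2\<close> vanishes when two
  coordinates coincide or one equals 1, the sum over all nodes is \<open>n!\<close> times the sum over \<open>D_minus N\<close>
  (\<open>sum_strict_desc\<close>, \<open>integral_pullback_eq_sum\<close>).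
\<close>

section \<open>Functions that are polynomial in the coordinates \<open>X\<^sub>1, \<dots>, X\<^sub>n\<close>\<close>

lemma rpoly_eval_superset:
  assumes "finite K" "Poly_Mapping.keys p \<subseteq> K"
  shows "rpoly_eval p Y =
    (\<Sum>m\<in>K. Poly_Mapping.lookup p m * (\<Prod>i\<in>UNIV. (Y $ i) ^ Poly_Mapping.lookup m i))"
  unfolding rpoly_eval_def using assms
  by (intro sum.mono_neutral_left) (auto simp: in_keys_iff)

lemma rpoly_eval_add: "rpoly_eval (p + q) Y = rpoly_eval p Y + rpoly_eval q Y"
proof -
  let ?K = "Poly_Mapping.keys p \<union> Poly_Mapping.keys q"
  have "Poly_Mapping.keys (p + q) \<subseteq> ?K" by (rule Poly_Mapping.keys_add)
  then show ?thesis
    by (simp add: rpoly_eval_superset[of ?K] lookup_add distrib_right sum.distrib)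
qed

lemma rpoly_eval_single:
  "rpoly_eval (Poly_Mapping.single m a) Y = a * (\<Prod>i\<in>UNIV. (Y $ i) ^ Poly_Mapping.lookup m i)"
  by (simp add: rpoly_eval_superset[of "{m}"])

definition poly_in_phi :: "(real^'n::{finite,wellorder} \<Rightarrow> real) \<Rightarrow> bool" where
  "poly_in_phi g \<longleftrightarrow> (\<exists>p. \<forall>x. rpoly_eval p (phi x) = g x)"

lemma poly_in_phi_monom:
  "poly_in_phi (\<lambda>x. a * (\<Prod>i\<in>UNIV. (phi x $ i) ^ Poly_Mapping.lookup m i))"
  unfolding poly_in_phi_def by (intro exI[of _ "Poly_Mapping.single m a"]) (simp add: rpoly_eval_single)

lemma poly_in_phi_const: "poly_in_phi (\<lambda>x. a)"
  using poly_in_phi_monom[of a 0] by simp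

lemma poly_in_phi_add: "poly_in_phi f \<Longrightarrow> poly_in_phi g \<Longrightarrow> poly_in_phi (\<lambda>x. f x + g x)"
  unfolding poly_in_phi_def by (metis rpoly_eval_add)

lemma poly_in_phi_sum: "(\<And>s. s \<in> S \<Longrightarrow> poly_in_phi (f s)) \<Longrightarrow> poly_in_phi (\<lambda>x. \<Sum>s\<in>S. f s x)"
  by (induction S rule: infinite_finite_induct) (auto intro: poly_in_phi_const poly_in_phi_add)

lemma poly_in_phi_mult:
  assumes "poly_in_phi f" "poly_in_phi g"
  shows "poly_in_phi (\<lambda>x. f x * g x)"
proof -
  obtain p q where p: "\<And>x. f x = rpoly_eval p (phi x)" and q: "\<And>x. g x = rpoly_eval q (phi x)"
    using assms unfolding poly_in_phi_def by metis
  have "poly_in_phi (\<lambda>x. \<Sum>m\<in>Poly_Mapping.keys p. \<Sum>k\<in>Poly_Mapping.keys q.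
     (Poly_Mapping.lookup p m * Poly_Mapping.lookup q k) *
     (\<Prod>i\<in>UNIV. (phi x $ i) ^ Poly_Mapping.lookup (m + k) i))"
    by (intro poly_in_phi_sum poly_in_phi_monom)
  moreover have "(\<Sum>m\<in>Poly_Mapping.keys p. \<Sum>k\<in>Poly_Mapping.keys q.
     (Poly_Mapping.lookup p m * Poly_Mapping.lookup q k) *
     (\<Prod>i\<in>UNIV. (phi x $ i) ^ Poly_Mapping.lookup (m + k) i)) = f x * g x" for x
    unfolding p q rpoly_eval_def sum_product lookup_add power_add prod.distrib
    by (simp add: mult_ac)
  ultimately show ?thesis by simp
qed

lemma poly_in_phi_prod: "(\<And>s. s \<in> S \<Longrightarrow> poly_in_phi (f s)) \<Longrightarrow> poly_in_phi (\<lambda>x. \<Prod>s\<in>S. f s x)"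
  by (induction S rule: infinite_finite_induct) (auto intro: poly_in_phi_const poly_in_phi_mult)

lemma poly_in_phi_Xfun: "poly_in_phi (\<lambda>x. Xfun j x)"
proof -
  have "poly_in_phi (\<lambda>x. 1 * (\<Prod>i\<in>UNIV. (phi x $ i) ^ Poly_Mapping.lookup (Poly_Mapping.single j 1) i))"
    by (rule poly_in_phi_monom)
  moreover have "1 * (\<Prod>i\<in>UNIV. (phi x $ i) ^ Poly_Mapping.lookup (Poly_Mapping.single j 1) i) = Xfun j x" for x
  proof -
    have "(\<Prod>i\<in>UNIV. (phi x $ i) ^ Poly_Mapping.lookup (Poly_Mapping.single j 1) i)
       = (\<Prod>i\<in>UNIV. if j = i then phi x $ i else 1)"
      by (intro prod.cong) (auto simp: lookup_single when_def)
    then show ?thesis by (simp add: prod.delta' phi_def)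
  qed
  ultimately show ?thesis by simp
qed


section \<open>Elementary symmetric functions\<close>

definition elem_sym :: "nat \<Rightarrow> 'i set \<Rightarrow> ('i \<Rightarrow> real) \<Rightarrow> real" where
  "elem_sym m A c = (\<Sum>S | S \<subseteq> A \<and> card S = m. \<Prod>i\<in>S. c i)"

lemma elem_sym_0 [simp]: "finite A \<Longrightarrow> elem_sym 0 A c = 1"
proof -
  assume "finite A"
  then have "{S. S \<subseteq> A \<and> card S = 0} = {{}}" by (auto dest: finite_subset)
  then show ?thesis by (simp add: elem_sym_def)
qed

lemma elem_sym_eq_0: "finite A \<Longrightarrow> card A < m \<Longrightarrow> elem_sym m A c = 0"
proof -
  assume "finite A" "card A < m"
  then have "\<not> (S \<subseteq> A \<and> card S = m)" for S
    using card_mono[of A S] by linarith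
  then have empty: "{S. S \<subseteq> A \<and> card S = m} = {}" by blast
  show ?thesis unfolding elem_sym_def empty by simp
qed

lemma elem_sym_generating:
  assumes "finite A"
  shows "(\<Prod>k\<in>A. t + c k) = (\<Sum>m\<le>card A. elem_sym m A c * t ^ (card A - m))"
proof -
  have "(\<Prod>k\<in>A. t + c k) = (\<Prod>k\<in>A. c k + t)" by (simp add: add.commute)
  also have "\<dots> = (\<Sum>S\<in>Pow A. (\<Prod>k\<in>S. c k) * t ^ (card A - card S))"
    unfolding prod_add[OF assms]
    using assms by (intro sum.cong) (auto simp: card_Diff_subset finite_subset)
  also have "\<dots> = (\<Sum>m\<le>card A. \<Sum>S\<in>{S\<in>Pow A. card S = m}. (\<Prod>k\<in>S. c k) * t ^ (card A - card S))"
    using assms by (intro sum.group[symmetric]) (auto intro: card_mono)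
  also have "\<dots> = (\<Sum>m\<le>card A. elem_sym m A c * t ^ (card A - m))"
    unfolding elem_sym_def sum_distrib_right by (intro sum.cong) auto
  finally show ?thesis .
qed

lemma sum_elem_sym_containing:
  assumes "finite A" "i \<in> A"
  shows "(\<Sum>S | S \<subseteq> A \<and> card S = Suc m \<and> i \<in> S. \<Prod>k\<in>S - {i}. c k) = elem_sym m (A - {i}) c"
  unfolding elem_sym_def
proof (rule sum.reindex_bij_witness[of _ "insert i" "\<lambda>S. S - {i}"])
  fix S assume "S \<in> {S. S \<subseteq> A - {i} \<and> card S = m}"
  then have S: "S \<subseteq> A - {i}" "card S = m" "finite S" "i \<notin> S"
    using assms finite_subset by auto
  show "insert i S - {i} = S" using S by auto
  show "insert i S \<in> {S. S \<subseteq> A \<and> card S = Suc m \<and> i \<in> S}" using S assms by auto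
next
  fix S assume "S \<in> {S. S \<subseteq> A \<and> card S = Suc m \<and> i \<in> S}"
  then have S: "S \<subseteq> A" "card S = Suc m" "i \<in> S" by auto
  show "insert i (S - {i}) = S" using S by auto
  show "S - {i} \<in> {S. S \<subseteq> A - {i} \<and> card S = m}" using S by (auto simp: card_Diff_singleton)
qed simp

lemma elem_sym_Suc:
  assumes "finite A" "i \<in> A"
  shows "elem_sym (Suc m) A c = elem_sym (Suc m) (A - {i}) c + c i * elem_sym m (A - {i}) c"
proof -
  have split: "{S. S \<subseteq> A \<and> card S = Suc m} =
     {S. S \<subseteq> A - {i} \<and> card S = Suc m} \<union> {S. S \<subseteq> A \<and> card S = Suc m \<and> i \<in> S}" by auto
  have "(\<Prod>k\<in>S. c k) = c i * (\<Prod>k\<in>S - {i}. c k)" if "S \<subseteq> A" "i \<in> S" for S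
    using that assms finite_subset by (intro prod.remove) auto
  then have "(\<Sum>S | S \<subseteq> A \<and> card S = Suc m \<and> i \<in> S. \<Prod>k\<in>S. c k) = c i * elem_sym m (A - {i}) c"
    unfolding sum_elem_sym_containing[OF assms, symmetric] sum_distrib_left
    by (intro sum.cong) auto
  then show ?thesis
    unfolding elem_sym_def[of "Suc m"] split
    using assms by (subst sum.union_disjoint) auto
qed

text \<open>
  The recursion \<open>elem_sym_Suc\<close>, solved for the set without \<open>i\<close> and iterated.
  Summing this formula over \<open>i\<close> gives Newton's identities, and it rewrites the partial derivatives of
  the \<open>X\<^sub>j\<close> as polynomials in \<open>c i\<close>.
\<close>

lemma elem_sym_omit:
  assumes "finite A" "i \<in> A"
  shows "elem_sym m (A - {i}) c = (\<Sum>l\<le>m. (- c i) ^ l * elem_sym (m - l) A c)"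
proof (induction m)
  case 0
  then show ?case using assms by simp
next
  case (Suc m)
  have "(\<Sum>l\<le>Suc m. (- c i) ^ l * elem_sym (Suc m - l) A c)
      = elem_sym (Suc m) A c + (- c i) * (\<Sum>l\<le>m. (- c i) ^ l * elem_sym (m - l) A c)"
    by (subst sum.atMost_Suc_shift) (simp add: sum_distrib_left mult.assoc)
  then show ?case using elem_sym_Suc[OF assms, of m c] Suc by simp
qed

lemma sum_elem_sym_omit:
  assumes "finite A"
  shows "(\<Sum>i\<in>A. elem_sym m (A - {i}) c) = (real (card A) - real m) * elem_sym m A c"
proof -
  let ?P = "{S. S \<subseteq> A \<and> card S = m}"
  have "(\<Sum>i\<in>A. elem_sym m (A - {i}) c) = (\<Sum>i\<in>A. \<Sum>S\<in>?P. if i \<in> S then 0 else \<Prod>k\<in>S. c k)"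
    unfolding elem_sym_def
  proof (rule sum.cong[OF refl])
    fix i assume "i \<in> A"
    have "(\<Sum>S\<in>?P. if i \<in> S then 0 else \<Prod>k\<in>S. c k) = (\<Sum>S\<in>{S\<in>?P. i \<notin> S}. \<Prod>k\<in>S. c k)"
      using assms by (subst sum.inter_filter) (auto intro!: sum.cong)
    also have "{S\<in>?P. i \<notin> S} = {S. S \<subseteq> A - {i} \<and> card S = m}" by auto
    finally show "(\<Sum>S | S \<subseteq> A - {i} \<and> card S = m. \<Prod>k\<in>S. c k) =
        (\<Sum>S\<in>?P. if i \<in> S then 0 else \<Prod>k\<in>S. c k)" by simp
  qed
  also have "\<dots> = (\<Sum>S\<in>?P. \<Sum>i\<in>A. if i \<in> S then 0 else \<Prod>k\<in>S. c k)" by (rule sum.swap)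
  also have "\<dots> = (\<Sum>S\<in>?P. (real (card A) - real m) * (\<Prod>k\<in>S. c k))"
  proof (intro sum.cong refl)
    fix S assume S: "S \<in> ?P"
    have "(\<Sum>i\<in>A. if i \<in> S then 0 else \<Prod>k\<in>S. c k) = (\<Sum>i\<in>A - S. \<Prod>k\<in>S. c k)"
      using assms by (intro sum.mono_neutral_cong_right) auto
    then show "(\<Sum>i\<in>A. if i \<in> S then 0 else \<Prod>k\<in>S. c k) = (real (card A) - real m) * (\<Prod>k\<in>S. c k)"
      using S assms by (auto simp: card_Diff_subset finite_subset of_nat_diff card_mono)
  qed
  finally show ?thesis by (simp add: elem_sym_def sum_distrib_left)
qed

text \<open>
  The sum over \<open>i\<close> of \<open>elem_sym m (A - {i}) c\<close> is evaluated in two ways, by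
  \<open>sum_elem_sym_omit\<close> and by \<open>elem_sym_omit\<close>; the term with the highest power sum is isolated, so
  that the identity can serve as a recursion for the power sums.
\<close>

lemma newton_identity:
  assumes "finite A"
  shows "(- 1) ^ m * (\<Sum>i\<in>A. c i ^ m) =
    (real (card A) - real m) * elem_sym m A c - (\<Sum>l<m. (- 1) ^ l * (\<Sum>i\<in>A. c i ^ l) * elem_sym (m - l) A c)"
proof -
  have "(real (card A) - real m) * elem_sym m A c = (\<Sum>i\<in>A. \<Sum>l\<le>m. (- c i) ^ l * elem_sym (m - l) A c)"
    unfolding sum_elem_sym_omit[OF assms, symmetric]
    by (intro sum.cong refl elem_sym_omit assms)
  also have "\<dots> = (\<Sum>l\<le>m. (- 1) ^ l * (\<Sum>i\<in>A. c i ^ l) * elem_sym (m - l) A c)"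
    by (subst sum.swap) (simp add: sum_distrib_left sum_distrib_right power_minus[of "c _"])
  also have "\<dots> = (\<Sum>l<m. (- 1) ^ l * (\<Sum>i\<in>A. c i ^ l) * elem_sym (m - l) A c) + (- 1) ^ m * (\<Sum>i\<in>A. c i ^ m)"
    using assms by (simp add: lessThan_Suc_atMost[symmetric])
  finally show ?thesis by simp
qed

text \<open>
  A bijection from \<open>S\<close> to \<open>T\<close> and one between the complements are glued together.
\<close>

lemma ex_permutes_image:
  fixes S T :: "'i::finite set"
  assumes "card S = card T"
  obtains \<tau> where "\<tau> permutes UNIV" "\<tau> -` T = S"
proof -
  obtain f where f: "bij_betw f S T" using assms finite_same_card_bij by (metis finite)
  have "card (- S) = card (- T)" using assms by (simp add: Compl_eq_Diff_UNIV card_Diff_subset)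
  then obtain g where g: "bij_betw g (- S) (- T)" using finite_same_card_bij by (metis finite)
  let ?h = "\<lambda>i. if i \<in> S then f i else g i"
  have "bij_betw ?h (S \<union> - S) (T \<union> - T)"
    by (rule bij_betw_disjoint_Un[OF f g]) auto
  then have "bij ?h" by simp
  moreover have "?h -` T = S"
    using bij_betwE[OF f] bij_betwE[OF g] by (auto split: if_splits)
  ultimately show ?thesis using that[of ?h] by (simp add: permutes_univ bij_iff)
qed

abbreviation cosv :: "real^'n::finite \<Rightarrow> 'n \<Rightarrow> real" where
  "cosv x \<equiv> (\<lambda>i. cos (pi * x $ i))"

lemma pos_eq: "pos i = card {..i}"
  by (simp add: pos_def atMost_def)

text \<open>
  The constant is \<open>j! (n - j)!\<close> for the index in position \<open>j\<close>.
\<close>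

definition Xnorm :: "'n::{finite,wellorder} \<Rightarrow> nat" where
  "Xnorm j = card {\<sigma>. \<sigma> permutes UNIV \<and> \<sigma> -` {..j} = {..j}}"

lemma Xnorm_pos: "Xnorm j > 0"
proof -
  have "id \<in> {\<sigma>. \<sigma> permutes UNIV \<and> \<sigma> -` {..j} = {..j}}" by (auto simp: permutes_id)
  moreover have "finite {\<sigma>. \<sigma> permutes UNIV \<and> \<sigma> -` {..j} = {..j}}" by simp
  ultimately show ?thesis unfolding Xnorm_def by (metis card_gt_0_iff empty_iff)
qed

text \<open>
  The permutations are grouped by the preimage \<open>S\<close> of \<open>{..j}\<close>. Composition with a permutation
  that takes \<open>S\<close> to \<open>{..j}\<close> shows that all groups with \<open>card S = pos j\<close> have the same size.
\<close>

lemma Xfun_elem_sym: "Xfun j x = Xnorm j * elem_sym (pos j) UNIV (cosv x)"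
proof -
  let ?P = "{\<sigma>. \<sigma> permutes (UNIV :: 'a set)}"
  let ?T = "{..j}"
  define K where "K = card {\<sigma>\<in>?P. \<sigma> -` ?T = ?T}"
  have finP: "finite ?P" by (simp add: finite_permutations)
  have K: "card {\<sigma>\<in>?P. \<sigma> -` ?T = S} = K" if S: "card S = pos j" for S
  proof -
    obtain \<tau> where \<tau>: "\<tau> permutes UNIV" "\<tau> -` ?T = S"
      using ex_permutes_image[of S ?T] S by (metis pos_eq)
    have "bij_betw (\<lambda>\<sigma>. \<sigma> \<circ> \<tau>) {\<sigma>\<in>?P. \<sigma> -` ?T = ?T} {\<sigma>\<in>?P. \<sigma> -` ?T = S}"
    proof (rule bij_betw_byWitness[of _ "\<lambda>\<sigma>. \<sigma> \<circ> inv \<tau>"])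
      show "\<forall>\<sigma>\<in>{\<sigma>\<in>?P. \<sigma> -` ?T = ?T}. \<sigma> \<circ> \<tau> \<circ> inv \<tau> = \<sigma>"
        using \<tau> by (simp add: comp_assoc permutes_inv_o)
      show "\<forall>\<sigma>\<in>{\<sigma>\<in>?P. \<sigma> -` ?T = S}. \<sigma> \<circ> inv \<tau> \<circ> \<tau> = \<sigma>"
        using \<tau> by (simp add: comp_assoc permutes_inv_o)
      show "(\<lambda>\<sigma>. \<sigma> \<circ> \<tau>) ` {\<sigma>\<in>?P. \<sigma> -` ?T = ?T} \<subseteq> {\<sigma>\<in>?P. \<sigma> -` ?T = S}"
        using \<tau> by (auto simp: permutes_compose vimage_comp[symmetric])
      have "inv \<tau> -` S = ?T"
        using \<tau> by (metis (no_types) vimage_comp permutes_inv_o(1) vimage_id id_apply)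
      then show "(\<lambda>\<sigma>. \<sigma> \<circ> inv \<tau>) ` {\<sigma>\<in>?P. \<sigma> -` ?T = S} \<subseteq> {\<sigma>\<in>?P. \<sigma> -` ?T = ?T}"
        using permutes_compose[OF permutes_inv[OF \<tau>(1)]] by (fastforce simp: vimage_def set_eq_iff)
    qed
    then show ?thesis unfolding K_def by (simp add: bij_betw_same_card)
  qed
  have "Xfun j x = real K * elem_sym (pos j) UNIV (cosv x)" for x
  proof -
    have "Xfun j x = (\<Sum>\<sigma>\<in>?P. \<Prod>i\<in>\<sigma> -` ?T. cosv x i)"
      unfolding Xfun_def cos_plus_def
    proof (intro sum.cong refl)
      fix \<sigma>
      show "(\<Prod>i\<in>UNIV. cos (pi * (\<chi> k. if k \<le> j then 1 else 0) $ \<sigma> i * x $ i)) = (\<Prod>i\<in>\<sigma> -` ?T. cosv x i)"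
        by (intro prod.mono_neutral_cong_right) auto
    qed
    also have "\<dots> = (\<Sum>S\<in>{S. S \<subseteq> UNIV \<and> card S = pos j}. \<Sum>\<sigma>\<in>{\<sigma>\<in>?P. \<sigma> -` ?T = S}. \<Prod>i\<in>\<sigma> -` ?T. cosv x i)"
    proof (rule sum.group[symmetric, OF finP])
      show "(\<lambda>\<sigma>. \<sigma> -` ?T) ` ?P \<subseteq> {S. S \<subseteq> UNIV \<and> card S = pos j}"
        by (auto simp: pos_eq card_vimage_inj permutes_inj permutes_surj)
    qed simp
    also have "\<dots> = (\<Sum>S\<in>{S. S \<subseteq> UNIV \<and> card S = pos j}. real K * (\<Prod>i\<in>S. cosv x i))"
      by (rule sum.cong[OF refl]) (simp add: K[simplified])
    finally show ?thesis by (simp add: elem_sym_def sum_distrib_left)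
  qed
  then show ?thesis by (simp add: K_def Xnorm_def)
qed

lemma bij_betw_pos: "bij_betw (pos :: 'n::{finite,wellorder} \<Rightarrow> nat) UNIV {1..CARD('n)}"
proof -
  have "strict_mono (pos :: 'n \<Rightarrow> nat)"
    unfolding strict_mono_def pos_eq by (intro allI impI psubset_card_mono) auto
  then have inj: "inj (pos :: 'n \<Rightarrow> nat)" by (rule strict_mono_imp_inj_on)
  have "pos i \<in> {1..CARD('n)}" for i :: 'n
    unfolding pos_eq by (auto simp: Suc_le_eq card_gt_0_iff intro: card_mono)
  then have "range (pos :: 'n \<Rightarrow> nat) = {1..CARD('n)}"
    using inj by (intro card_subset_eq) (auto simp: card_image)
  with inj show ?thesis by (simp add: bij_betw_def)
qed

lemma poly_in_phi_elem_sym: "poly_in_phi (\<lambda>x. elem_sym m UNIV (cosv x))"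
proof -
  consider "m = 0" | "m > CARD('a)" | "m \<in> {1..CARD('a)}" by fastforce
  then show ?thesis
  proof cases
    case 3
    then obtain j :: 'a where j: "pos j = m" using bij_betw_pos unfolding bij_betw_def by (metis imageE)
    have "poly_in_phi (\<lambda>x. inverse (Xnorm j) * Xfun j x)"
      by (intro poly_in_phi_mult poly_in_phi_const poly_in_phi_Xfun)
    moreover have "inverse (Xnorm j) * Xfun j x = elem_sym m UNIV (cosv x)" for x
      using Xnorm_pos[of j] j by (simp add: Xfun_elem_sym)
    ultimately show ?thesis by simp
  qed (simp_all add: elem_sym_eq_0 poly_in_phi_const)
qed

lemma poly_in_phi_power_sum: "poly_in_phi (\<lambda>x::real^'n::{finite,wellorder}. \<Sum>i\<in>UNIV. cosv x i ^ m)"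
proof (induction m rule: less_induct)
  case (less m)
  define p where "p l x = (\<Sum>i\<in>UNIV. cosv x i ^ l)" for l and x :: "real^'n::_"
  define e where "e l x = elem_sym l UNIV (cosv x)" for l and x :: "real^'n::_"
  have p: "poly_in_phi (p l)" if "l < m" for l
    using less[OF that] unfolding p_def .
  have e: "poly_in_phi (e l)" for l
    unfolding e_def by (rule poly_in_phi_elem_sym)
  have "poly_in_phi (\<lambda>x. \<Sum>l<m. (- 1) ^ l * p l x * e (m - l) x)"
    by (rule poly_in_phi_sum) (auto intro!: poly_in_phi_mult poly_in_phi_const p e)
  then have *: "poly_in_phi (\<lambda>x. (- 1) ^ m * ((real CARD('n) - real m) * e m x
     + (- 1) * (\<Sum>l<m. (- 1) ^ l * p l x * e (m - l) x)))"
    by (intro poly_in_phi_mult[OF poly_in_phi_const] poly_in_phi_add e)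
  have "(- 1) ^ m * ((real CARD('n) - real m) * e m x
     + (- 1) * (\<Sum>l<m. (- 1) ^ l * p l x * e (m - l) x)) = p m x" for x
  proof -
    have "(real CARD('n) - real m) * e m x + (- 1) * (\<Sum>l<m. (- 1) ^ l * p l x * e (m - l) x)
      = (- 1) ^ m * p m x"
      using newton_identity[OF finite, of m "cosv x" UNIV] by (simp add: p_def e_def)
    then show ?thesis by (simp add: mult.assoc[symmetric] power_add[symmetric] flip: mult_2)
  qed
  with * show ?case by (simp add: p_def)
qed

lemma poly_in_phi_sum_poly: "poly_in_phi (\<lambda>x::real^'n::{finite,wellorder}. \<Sum>i\<in>UNIV. poly q (cosv x i))"
proof -
  have "poly_in_phi (\<lambda>x::real^'n::_. \<Sum>l\<le>degree q. coeff q l * (\<Sum>i\<in>UNIV. cosv x i ^ l))"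
    by (rule poly_in_phi_sum, rule poly_in_phi_mult[OF poly_in_phi_const poly_in_phi_power_sum])
  moreover have "(\<Sum>l\<le>degree q. coeff q l * (\<Sum>i\<in>UNIV. cosv x i ^ l)) = (\<Sum>i\<in>UNIV. poly q (cosv x i))"
    for x :: "real^'n::_"
    by (subst poly_altdef, subst sum.swap) (simp add: sum_distrib_left)
  ultimately show ?thesis by simp
qed


section \<open>The squared Jacobian and \<open>cos_minus rho2\<close> squared\<close>

lemma poly_in_phi_det:
  assumes "\<And>i j. poly_in_phi (\<lambda>x. M x $ i $ j)"
  shows "poly_in_phi (\<lambda>x. det (M x))"
  unfolding det_def
  by (rule poly_in_phi_sum, rule poly_in_phi_mult[OF poly_in_phi_const], rule poly_in_phi_prod, rule assms)

lemma cos_multiple_poly: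
  obtains q :: "real poly" where "degree q \<le> k" "\<And>\<theta>. cos (real k * \<theta>) = poly q (cos \<theta>)"
proof -
  have "\<exists>q. degree q \<le> k \<and> (\<forall>\<theta>. cos (real k * \<theta>) = poly q (cos \<theta>))"
  proof (induction k rule: induct_nat_012)
    case 0
    show ?case by (intro exI[of _ 1]) simp
  next
    case 1
    show ?case by (intro exI[of _ "[:0, 1:]"]) simp
  next
    case (ge2 k)
    then obtain p q where p: "degree p \<le> k" "\<And>\<theta>. cos (real k * \<theta>) = poly p (cos \<theta>)"
      and q: "degree q \<le> Suc k" "\<And>\<theta>. cos (real (Suc k) * \<theta>) = poly q (cos \<theta>)" by blast
    have "degree ([:0, 2:] * q - p) \<le> Suc (Suc k)"
      using p q degree_mult_le[of "[:0, 2:]" q] by (intro degree_diff_le) auto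
    moreover have "cos (real (Suc (Suc k)) * \<theta>) = poly ([:0, 2:] * q - p) (cos \<theta>)" for \<theta>
    proof -
      have "cos (real (Suc k) * \<theta> + \<theta>) + cos (real (Suc k) * \<theta> - \<theta>) = 2 * cos \<theta> * cos (real (Suc k) * \<theta>)"
        by (simp add: cos_add cos_diff)
      moreover have "real (Suc k) * \<theta> + \<theta> = real (Suc (Suc k)) * \<theta>" "real (Suc k) * \<theta> - \<theta> = real k * \<theta>"
        by (simp_all add: algebra_simps)
      ultimately show ?thesis using p(2)[of \<theta>] q(2)[of \<theta>] by simp
    qed
    ultimately show ?case by blast
  qed
  with that show ?thesis by blast
qed

text \<open>
  A single half-integer frequency does not give a polynomial in \<open>cos \<theta>\<close>, but by the product formula
  a product of two gives integer frequencies, the larger of which is \<open>a + b + 1\<close>.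
\<close>

lemma cos_half_integer_mult_poly:
  obtains q :: "real poly" where "degree q \<le> a + b + 1"
    "\<And>\<theta>. cos ((real a + 1/2) * \<theta>) * cos ((real b + 1/2) * \<theta>) = poly q (cos \<theta>)"
proof -
  obtain p where p: "degree p \<le> a + b + 1" "\<And>\<theta>. cos (real (a + b + 1) * \<theta>) = poly p (cos \<theta>)"
    using cos_multiple_poly by blast
  define d where "d = nat \<bar>int a - int b\<bar>"
  obtain r where r: "degree r \<le> d" "\<And>\<theta>. cos (real d * \<theta>) = poly r (cos \<theta>)"
    using cos_multiple_poly by blast
  have d: "cos (real d * \<theta>) = cos ((real a - real b) * \<theta>)" for \<theta>
  proof (cases "a \<ge> b")
    case False
    then have "real d = - (real a - real b)" by (simp add: d_def)
    then have e: "real d = - (real a - real b)" by (simp add: d_def)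
    show ?thesis unfolding e mult_minus_left by (rule Transcendental.cos_minus)
  next
    case True
    then have "real d = real a - real b" by (simp add: d_def)
    then show ?thesis by simp
  qed
  have "degree (smult (1/2) (p + r)) \<le> a + b + 1"
    using p r by (auto simp: d_def intro!: degree_add_le)
  moreover have "cos ((real a + 1/2) * \<theta>) * cos ((real b + 1/2) * \<theta>) = poly (smult (1/2) (p + r)) (cos \<theta>)" for \<theta>
  proof -
    have e: "(real a + 1/2) * \<theta> - (real b + 1/2) * \<theta> = (real a - real b) * \<theta>"
      "(real a + 1/2) * \<theta> + (real b + 1/2) * \<theta> = real (a + b + 1) * \<theta>" by (simp_all add: algebra_simps)
    show ?thesis
      unfolding cos_times_cos e d[symmetric] p(2) r(2) by simp
  qed
  ultimately show ?thesis using that by blast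
qed

text \<open>
  Antisymmetry and vanishing on coinciding arguments become properties of determinants.
\<close>

lemma cos_minus_det: "cos_minus l x = det (\<chi> i j. cos (pi * l $ j * x $ i))"
  unfolding cos_minus_def det_def by simp

lemma pos_bounds: "1 \<le> pos (i :: 'n::{finite,wellorder})" "pos i \<le> CARD('n)"
  using bij_betw_pos[where 'n = 'n] unfolding bij_betw_def by auto

lemma rho2_nth: "rho2 $ (i :: 'n::{finite,wellorder}) = real (CARD('n) - pos i) + 1/2"
  using pos_bounds(2)[of i] by (simp add: rho2_def of_nat_diff)

lemma cos_rho2_mult_poly:
  fixes a b :: "'n::{finite,wellorder}"
  obtains q :: "real poly" where "degree q \<le> 2 * CARD('n) - 1"
    "\<And>t. cos (pi * rho2 $ a * t) * cos (pi * rho2 $ b * t) = poly q (cos (pi * t))"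
proof -
  obtain q where q: "degree q \<le> (CARD('n) - pos a) + (CARD('n) - pos b) + 1"
    "\<And>\<theta>. cos ((real (CARD('n) - pos a) + 1/2) * \<theta>) * cos ((real (CARD('n) - pos b) + 1/2) * \<theta>) = poly q (cos \<theta>)"
    using cos_half_integer_mult_poly by blast
  have "degree q \<le> 2 * CARD('n) - 1"
    using q(1) pos_bounds[of a] pos_bounds[of b] by linarith
  moreover have "cos (pi * rho2 $ a * t) * cos (pi * rho2 $ b * t) = poly q (cos (pi * t))" for t
    using q(2)[of "pi * t"] by (simp add: rho2_nth mult_ac)
  ultimately show ?thesis using that by blast
qed

text \<open>
  For the matrix \<open>M\<close> of \<open>cos_minus_det\<close>, the square is the determinant of \<open>transpose M ** M\<close>, whose
  entries sum a product of two half-integer cosines over all variables.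
\<close>

lemma poly_in_phi_cos_minus: "poly_in_phi (\<lambda>x. (cos_minus rho2 x)\<^sup>2)"
proof -
  define M :: "real^'a::_ \<Rightarrow> real^'a::_^'a::_" where "M x = (\<chi> i j. cos (pi * rho2 $ j * x $ i))" for x
  have "poly_in_phi (\<lambda>x. det (transpose (M x) ** M x))"
  proof (rule poly_in_phi_det)
    fix a b :: 'a
    obtain q where q: "\<And>t. cos (pi * rho2 $ a * t) * cos (pi * rho2 $ b * t) = poly q (cos (pi * t))"
      using cos_rho2_mult_poly by blast
    have "(transpose (M x) ** M x) $ a $ b = (\<Sum>i\<in>UNIV. poly q (cosv x i))" for x
      unfolding matrix_matrix_mult_def transpose_def M_def by (simp add: q)
    then show "poly_in_phi (\<lambda>x. (transpose (M x) ** M x) $ a $ b)"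
      by (simp add: poly_in_phi_sum_poly)
  qed
  then show ?thesis
    by (simp add: det_mul power2_eq_square cos_minus_det M_def)
qed

lemma has_derivative_elem_sym:
  fixes c :: "'i \<Rightarrow> 'v::real_normed_vector \<Rightarrow> real"
  assumes "finite A" "\<And>i. i \<in> A \<Longrightarrow> (c i has_derivative c' i) (at x within S)"
  shows "((\<lambda>x. elem_sym (Suc m) A (\<lambda>i. c i x)) has_derivative
     (\<lambda>h. \<Sum>i\<in>A. c' i h * elem_sym m (A - {i}) (\<lambda>i. c i x))) (at x within S)"
proof -
  let ?P = "{S. S \<subseteq> A \<and> card S = Suc m}"
  have "((\<lambda>x. elem_sym (Suc m) A (\<lambda>i. c i x)) has_derivative
     (\<lambda>h. \<Sum>S\<in>?P. \<Sum>i\<in>S. c' i h * (\<Prod>k\<in>S - {i}. c k x))) (at x within S)"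
    unfolding elem_sym_def
    by (intro has_derivative_sum has_derivative_prod assms) auto
  also have "(\<lambda>h. \<Sum>S\<in>?P. \<Sum>i\<in>S. c' i h * (\<Prod>k\<in>S - {i}. c k x)) =
     (\<lambda>h. \<Sum>i\<in>A. c' i h * elem_sym m (A - {i}) (\<lambda>i. c i x))"
  proof
    fix h
    have "(\<Sum>S\<in>?P. \<Sum>i\<in>S. c' i h * (\<Prod>k\<in>S - {i}. c k x)) =
      (\<Sum>S\<in>?P. \<Sum>i\<in>{i\<in>A. i \<in> S}. c' i h * (\<Prod>k\<in>S - {i}. c k x))"
      by (intro sum.cong refl) auto
    also have "\<dots> = (\<Sum>i\<in>A. \<Sum>S\<in>{S\<in>?P. i \<in> S}. c' i h * (\<Prod>k\<in>S - {i}. c k x))"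
      using assms(1) by (intro sum.swap_restrict) auto
    also have "\<dots> = (\<Sum>i\<in>A. c' i h * elem_sym m (A - {i}) (\<lambda>i. c i x))"
    proof (rule sum.cong[OF refl])
      fix i assume i: "i \<in> A"
      have "{S\<in>?P. i \<in> S} = {S. S \<subseteq> A \<and> card S = Suc m \<and> i \<in> S}" by auto
      then show "(\<Sum>S\<in>{S\<in>?P. i \<in> S}. c' i h * (\<Prod>k\<in>S - {i}. c k x)) =
          c' i h * elem_sym m (A - {i}) (\<lambda>i. c i x)"
        using sum_elem_sym_containing[OF assms(1) i, where m = m and c = "\<lambda>i. c i x"]
        by (simp add: sum_distrib_left[symmetric])
    qed
    finally show "(\<Sum>S\<in>?P. \<Sum>i\<in>S. c' i h * (\<Prod>k\<in>S - {i}. c k x)) =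
      (\<Sum>i\<in>A. c' i h * elem_sym m (A - {i}) (\<lambda>i. c i x))" .
  qed
  finally show ?thesis .
qed

definition dphi :: "real^'n::{finite,wellorder} \<Rightarrow> real^'n::_ \<Rightarrow> real^'n::_" where
  "dphi x h = (\<chi> j. Xnorm j * (\<Sum>i\<in>UNIV. (- pi * sin (pi * x $ i) * h $ i) * elem_sym (pos j - 1) (UNIV - {i}) (cosv x)))"

lemma phi_has_derivative: "(phi has_derivative dphi x) (at x within S)"
proof -
  have "((\<lambda>x. phi x $ j) has_derivative (\<lambda>h. dphi x h $ j)) (at x within S)" for j
  proof -
    have c: "((\<lambda>x. cosv x i) has_derivative (\<lambda>h. - pi * sin (pi * x $ i) * h $ i)) (at x within S)" for i
      by (auto intro!: derivative_eq_intros bounded_linear_imp_has_derivative[OF bounded_linear_vec_nth])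
    obtain m where m: "pos j = Suc m" using pos_bounds(1)[of j] by (cases "pos j") auto
    have "((\<lambda>x. Xnorm j * elem_sym (Suc m) UNIV (cosv x)) has_derivative
      (\<lambda>h. Xnorm j * (\<Sum>i\<in>UNIV. (- pi * sin (pi * x $ i) * h $ i) * elem_sym m (UNIV - {i}) (cosv x)))) (at x within S)"
      by (intro has_derivative_mult_right has_derivative_elem_sym[OF finite c])
    then show ?thesis by (simp add: dphi_def phi_def Xfun_elem_sym m)
  qed
  then show ?thesis by (subst has_derivative_componentwise_within) (auto simp: Basis_vec_def inner_axis)
qed

lemma continuous_on_phi: "continuous_on S phi"
  unfolding continuous_on_eq_continuous_within
  by (intro ballI has_derivative_continuous[OF phi_has_derivative])

lemma Jac_eq: "Jac x = det (matrix (dphi x))"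
  unfolding Jac_def jacobian_def
  using frechet_derivative_at[OF phi_has_derivative[of x UNIV]] by simp

lemma matrix_dphi_nth: "matrix (dphi x) $ j $ i =
    Xnorm j * (- pi * sin (pi * x $ i)) * elem_sym (pos j - 1) (UNIV - {i}) (cosv x)"
proof -
  have "(\<Sum>k\<in>UNIV. (- pi * sin (pi * x $ k) * axis i 1 $ k) * elem_sym (pos j - 1) (UNIV - {k}) (cosv x))
    = (\<Sum>k\<in>UNIV. if k = i then (- pi * sin (pi * x $ k)) * elem_sym (pos j - 1) (UNIV - {k}) (cosv x) else 0)"
    by (intro sum.cong) (auto simp: axis_def)
  then show ?thesis by (simp add: matrix_def dphi_def)
qed

text \<open>
  Here the Gram matrix is \<open>A ** transpose A\<close> for the Jacobian matrix \<open>A\<close>. Its entries contain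
  \<open>sin\<^sup>2 = 1 - cos\<^sup>2\<close> and products of two elementary symmetric functions without the variable \<open>i\<close>, which
  \<open>elem_sym_omit\<close> turns into polynomials in \<open>cos (pi x\<^sub>i)\<close>.
\<close>

lemma poly_in_phi_Jac: "poly_in_phi (\<lambda>x. (Jac x)\<^sup>2)"
proof -
  let ?A = "\<lambda>x :: real^'a::_. matrix (dphi x)"
  have "poly_in_phi (\<lambda>x. det (?A x ** transpose (?A x)))"
  proof (rule poly_in_phi_det)
    fix j l :: 'a
    define J where "J = pos j - 1"
    define L where "L = pos l - 1"
    define e where "e m x = elem_sym m UNIV (cosv x)" for m and x :: "real^'a::_"
    define q :: "nat \<Rightarrow> nat \<Rightarrow> real poly" where "q a b = smult (pi\<^sup>2) ([:1, 0, -1:] * [:0, -1:] ^ a * [:0, -1:] ^ b)" for a b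
    have "poly_in_phi (\<lambda>x. (real (Xnorm j) * real (Xnorm l)) *
       (\<Sum>a\<le>J. \<Sum>b\<le>L. e (J - a) x * e (L - b) x * (\<Sum>i\<in>UNIV. poly (q a b) (cosv x i))))"
      unfolding e_def
      by (rule poly_in_phi_mult[OF poly_in_phi_const], rule poly_in_phi_sum, rule poly_in_phi_sum,
          rule poly_in_phi_mult[OF poly_in_phi_mult[OF poly_in_phi_elem_sym poly_in_phi_elem_sym] poly_in_phi_sum_poly])
    moreover have "(?A x ** transpose (?A x)) $ j $ l = (real (Xnorm j) * real (Xnorm l)) *
       (\<Sum>a\<le>J. \<Sum>b\<le>L. e (J - a) x * e (L - b) x * (\<Sum>i\<in>UNIV. poly (q a b) (cosv x i)))" for x
    proof -
      define c where "c = cosv x"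
      define s where "s i = pi * sin (pi * x $ i)" for i
      have s: "(s i)\<^sup>2 = pi\<^sup>2 * (1 - (c i)\<^sup>2)" for i
        unfolding s_def c_def power_mult_distrib sin_squared_eq ..
      have q: "poly (q a b) (c i) = (s i)\<^sup>2 * (- c i) ^ a * (- c i) ^ b" for a b i
        unfolding s by (simp add: q_def power2_eq_square algebra_simps)
      have e: "elem_sym m (UNIV - {i}) c = (\<Sum>l\<le>m. (- c i) ^ l * e (m - l) x)" for m i
        unfolding e_def c_def by (rule elem_sym_omit) auto
      have "(?A x ** transpose (?A x)) $ j $ l = (\<Sum>i\<in>UNIV. (real (Xnorm j) * real (Xnorm l)) *
         ((s i)\<^sup>2 * (elem_sym J (UNIV - {i}) c * elem_sym L (UNIV - {i}) c)))"
        unfolding matrix_matrix_mult_def transpose_def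
        by (simp add: matrix_dphi_nth J_def L_def power2_eq_square mult_ac s_def c_def)
      also have "\<dots> = (real (Xnorm j) * real (Xnorm l)) * (\<Sum>i\<in>UNIV. \<Sum>a\<le>J. \<Sum>b\<le>L.
         e (J - a) x * e (L - b) x * poly (q a b) (c i))"
        unfolding sum_distrib_left[symmetric, where r = "real (Xnorm j) * real (Xnorm l)"]
        by (rule arg_cong[where f = "\<lambda>t. _ * t"], rule sum.cong[OF refl])
           (unfold e sum_product, unfold sum_distrib_left, intro sum.cong refl, simp add: q)
      also have "(\<Sum>i\<in>UNIV. \<Sum>a\<le>J. \<Sum>b\<le>L. e (J - a) x * e (L - b) x * poly (q a b) (c i))
        = (\<Sum>a\<le>J. \<Sum>b\<le>L. \<Sum>i\<in>UNIV. e (J - a) x * e (L - b) x * poly (q a b) (c i))"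
        by (subst sum.swap, rule sum.cong[OF refl], rule sum.swap)
      finally show ?thesis by (simp add: sum_distrib_left c_def)
    qed
    ultimately show "poly_in_phi (\<lambda>x. (?A x ** transpose (?A x)) $ j $ l)" by simp
  qed
  then show ?thesis by (simp add: det_mul power2_eq_square Jac_eq)
qed

lemma pI_plus_phi: "rpoly_eval pI_plus (phi x) = (Jac x)\<^sup>2"
  using someI_ex[OF poly_in_phi_Jac[unfolded poly_in_phi_def]] unfolding pI_plus_def by blast

lemma calJ_III_minus_phi: "rpoly_eval calJ_III_minus (phi x) = (cos_minus rho2 x)\<^sup>2"
  using someI_ex[OF poly_in_phi_cos_minus[unfolded poly_in_phi_def]] unfolding calJ_III_minus_def by blast

lemma calJ_phi: "calJ (phi x) = \<bar>Jac x\<bar>"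
  by (simp add: calJ_def pI_plus_phi)

section \<open>Injectivity and regularity of \<open>phi\<close>; change of variables\<close>

lemma elem_sym_eq_of_phi_eq:
  assumes "phi x = phi y"
  shows "elem_sym m UNIV (cosv x) = elem_sym m UNIV (cosv (y :: real^'n::{finite,wellorder}))"
proof -
  consider "m = 0" | "m > CARD('n)" | "m \<in> {1..CARD('n)}" by fastforce
  then show ?thesis
  proof cases
    case 3
    then obtain j :: 'n where j: "pos j = m" using bij_betw_pos unfolding bij_betw_def by (metis imageE)
    have "phi x $ j = phi y $ j" using assms by simp
    then show ?thesis using Xnorm_pos[of j] by (simp add: phi_def Xfun_elem_sym j)
  qed (simp_all add: elem_sym_eq_0)
qed

text \<open>
  Equal values of \<open>phi\<close> give equal polynomials \<open>\<Prod>(t + c\<^sub>k)\<close>, hence equal multisets of roots; as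
  \<open>cos (pi x\<^sub>k)\<close> increases with \<open>k\<close> on \<open>fund_dom\<close>, the sorted lists agree entry by entry.
\<close>

lemma inj_on_phi: "inj_on phi (fund_dom :: (real^'n::{finite,wellorder}) set)"
proof (rule inj_onI)
  fix x y :: "real^'n::_"
  assume x: "x \<in> fund_dom" and y: "y \<in> fund_dom" and eq: "phi x = phi y"
  have "(\<Prod>k\<in>UNIV. [:cosv x k, 1:]) = (\<Prod>k\<in>UNIV. [:cosv y k, 1:])"
  proof (rule poly_eq_poly_eq_iff[THEN iffD1], rule ext)
    fix t
    have "(\<Prod>k\<in>UNIV. t + cosv x k) = (\<Prod>k\<in>UNIV. t + cosv y k)"
      unfolding elem_sym_generating[OF finite] elem_sym_eq_of_phi_eq[OF eq] ..
    then show "poly (\<Prod>k\<in>UNIV. [:cosv x k, 1:]) t = poly (\<Prod>k\<in>UNIV. [:cosv y k, 1:]) t"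
      by (simp add: poly_prod add.commute)
  qed
  then have "proots (\<Prod>k\<in>UNIV. [:cosv x k, 1:]) = proots (\<Prod>k\<in>UNIV. [:cosv y k, 1:])"
    by simp
  then have "image_mset (\<lambda>k. - cosv x k) (mset_set UNIV) = image_mset (\<lambda>k. - cosv y k) (mset_set UNIV)"
    by (simp add: proots_prod sum_unfold_sum_mset)
  then have "image_mset uminus (image_mset (\<lambda>k. - cosv x k) (mset_set UNIV))
      = image_mset uminus (image_mset (\<lambda>k. - cosv y k) (mset_set UNIV))"
    by simp
  then have ms: "image_mset (cosv x) (mset_set UNIV) = image_mset (cosv y) (mset_set UNIV)"
    by (simp add: image_mset.compositionality o_def)
  define L where "L = sorted_list_of_set (UNIV :: 'n set)"
  have mono: "sorted (map (cosv z) L)" if "z \<in> fund_dom" for z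
  proof -
    have "cosv z i \<le> cosv z j" if "i \<le> j" for i j
      using that \<open>z \<in> fund_dom\<close> unfolding fund_dom_def
      by (intro cos_monotone_0_pi_le) auto
    then show ?thesis
      unfolding sorted_map L_def
      by (intro sorted_wrt_mono_rel[OF _ sorted_sorted_list_of_set]) auto
  qed
  have "mset (map (cosv x) L) = mset (map (cosv y) L)"
    using ms by (simp add: L_def mset_set_set[symmetric])
  then have "map (cosv x) L = map (cosv y) L"
    using mono[OF x] mono[OF y] properties_for_sort by metis
  then have "cosv x i = cosv y i" for i
    using map_eq_conv[of "cosv x" L "cosv y"] unfolding L_def by simp
  then have "x $ i = y $ i" for i
    using x y cos_inj_pi[of "pi * x $ i" "pi * y $ i"] by (auto simp: fund_dom_def)
  then show "x = y" by (simp add: vec_eq_iff)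
qed

text \<open>
  If \<open>u\<close> is in the kernel of the Jacobian matrix, the polynomial
  \<open>\<Sum>i. u\<^sub>i sin (pi x\<^sub>i) \<Prod>k\<noteq>i. (t + c\<^sub>k)\<close> has only zero coefficients; its value at \<open>t = - c\<^sub>i\<close> contains
  the \<open>i\<close>-th summand alone, which forces \<open>u\<^sub>i = 0\<close>.
\<close>

lemma Jac_nonzero:
  assumes x: "\<And>i. 0 < x $ i \<and> x $ i < 1" "inj (\<lambda>i. x $ (i :: 'n::{finite,wellorder}))"
  shows "Jac x \<noteq> 0"
proof
  assume "Jac x = 0"
  then have "\<not> (\<exists>B. B ** matrix (dphi x) = mat 1)"
    by (metis Jac_eq invertible_det_nz invertible_left_inverse)
  then obtain u where u: "matrix (dphi x) *v u = 0" "u \<noteq> 0"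
    unfolding matrix_left_invertible_ker by blast
  define s where "s i = - pi * sin (pi * x $ i) * u $ i" for i
  have e: "(\<Sum>i\<in>UNIV. s i * elem_sym m (UNIV - {i}) (cosv x)) = 0" if "m < CARD('n)" for m
  proof -
    from that have "Suc m \<in> {1..CARD('n)}" by simp
    then obtain j :: 'n where j: "pos j = Suc m" using bij_betw_pos unfolding bij_betw_def by (metis imageE)
    have "0 = (matrix (dphi x) *v u) $ j" using u by simp
    also have "\<dots> = Xnorm j * (\<Sum>i\<in>UNIV. s i * elem_sym m (UNIV - {i}) (cosv x))"
      unfolding matrix_vector_mult_def matrix_dphi_nth vec_lambda_beta j sum_distrib_left s_def
      by (rule sum.cong) (auto simp: mult_ac)
    finally show ?thesis using Xnorm_pos[of j] by simp
  qed
  have gen: "(\<Sum>i\<in>UNIV. s i * (\<Prod>k\<in>UNIV - {i}. t + cosv x k)) = 0" for t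
  proof -
    have "(\<Sum>i\<in>UNIV. s i * (\<Prod>k\<in>UNIV - {i}. t + cosv x k)) =
      (\<Sum>i\<in>UNIV. \<Sum>m\<le>CARD('n) - 1. t ^ (CARD('n) - 1 - m) * (s i * elem_sym m (UNIV - {i}) (cosv x)))"
      by (simp add: elem_sym_generating card_Diff_singleton sum_distrib_left mult_ac)
    also have "\<dots> = (\<Sum>m\<le>CARD('n) - 1. t ^ (CARD('n) - 1 - m) * (\<Sum>i\<in>UNIV. s i * elem_sym m (UNIV - {i}) (cosv x)))"
      by (subst sum.swap) (simp add: sum_distrib_left)
    also have "\<dots> = 0"
    proof (rule sum.neutral, rule ballI)
      fix m assume "m \<in> {..CARD('n) - 1}"
      moreover have "CARD('n) > 0" by (simp add: card_gt_0_iff)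
      ultimately have "m < CARD('n)" by (simp only: atMost_iff)
      then show "t ^ (CARD('n) - 1 - m) * (\<Sum>i\<in>UNIV. s i * elem_sym m (UNIV - {i}) (cosv x)) = 0"
        using e by simp
    qed
    finally show ?thesis .
  qed
  have "u $ i = 0" for i
  proof -
    have "(\<Sum>l\<in>UNIV. s l * (\<Prod>k\<in>UNIV - {l}. - cosv x i + cosv x k)) =
        (\<Sum>l\<in>{i}. s l * (\<Prod>k\<in>UNIV - {l}. - cosv x i + cosv x k))"
      by (rule sum.mono_neutral_right) auto
    then have "s i * (\<Prod>k\<in>UNIV - {i}. - cosv x i + cosv x k) = 0"
      using gen[of "- cosv x i"] by simp
    moreover have "cosv x k \<noteq> cosv x i" if "k \<noteq> i" for k
    proof
      assume eq: "cosv x k = cosv x i"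
      have b: "0 \<le> pi * x $ l" "pi * x $ l \<le> pi" for l
        using x(1)[of l] by simp_all
      have "pi * x $ k = pi * x $ i"
        by (rule cos_inj_pi[OF b b eq])
      then have "x $ k = x $ i" by simp
      then show False using injD[OF x(2), of k i] that by simp
    qed
    ultimately have "s i = 0" by (simp add: prod_zero_iff)
    moreover have "sin (pi * x $ i) > 0"
      using x(1)[of i] by (intro sin_gt_zero) auto
    ultimately show ?thesis by (simp add: s_def)
  qed
  then show False using u(2) by (simp add: vec_eq_iff)
qed

lemma compact_fund_dom: "compact (fund_dom :: (real^'n::{finite,wellorder}) set)"
proof -
  have "fund_dom \<subseteq> cbox 0 (1 :: real^'n::_)" by (auto simp: fund_dom_def mem_box_cart)
  then have "bounded (fund_dom :: (real^'n::_) set)" using bounded_cbox bounded_subset by blast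
  moreover have "closed (fund_dom :: (real^'n::_) set)"
    unfolding fund_dom_def
    by (intro closed_Collect_conj closed_Collect_all closed_Collect_imp closed_Collect_le open_Collect_const continuous_intros)
  ultimately show ?thesis by (simp add: compact_eq_bounded_closed)
qed

lemma negligible_coordinates_eq: "i \<noteq> j \<Longrightarrow> negligible {x :: real^'n. x $ i = x $ j}"
proof -
  assume "i \<noteq> j"
  then have "axis i 1 - axis j 1 \<noteq> (0 :: real^'n)" by (auto simp: vec_eq_iff axis_def)
  then have "negligible {x :: real^'n. (axis i 1 - axis j 1) \<bullet> x = 0}"
    by (intro negligible_hyperplane) auto
  then show ?thesis by (simp add: inner_diff_left inner_axis' )
qed

lemma negligible_coordinate_eq_const: "negligible {x :: real^'n. x $ i = a}"
  using negligible_hyperplane[of "axis i 1 :: real^'n" a] by (simp add: inner_axis' axis_eq_0_iff)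

lemma negligible_coincident: "negligible {x :: real^'n. \<not> inj (\<lambda>i. x $ i)}"
proof -
  have "{x :: real^'n. \<not> inj (\<lambda>i. x $ i)} = (\<Union>(i, j)\<in>{(i, j). i \<noteq> j}. {x. x $ i = x $ j})"
    by (auto simp: inj_def)
  also have "negligible \<dots>"
    by (intro negligible_Union) (auto intro: negligible_coordinates_eq)
  finally show ?thesis .
qed

lemma negligible_Jac_eq_0: "negligible {x \<in> fund_dom. Jac x = 0}"
proof (rule negligible_subset)
  show "negligible ((\<Union>i. {x :: real^'a::_. x $ i = 0}) \<union> (\<Union>i. {x. x $ i = 1}) \<union> {x. \<not> inj (\<lambda>i. x $ i)})"
    by (intro negligible_Un negligible_Union negligible_coincident) (auto intro: negligible_coordinate_eq_const)
  show "{x \<in> fund_dom. Jac x = 0} \<subseteq>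
      (\<Union>i. {x :: real^'a::_. x $ i = 0}) \<union> (\<Union>i. {x. x $ i = 1}) \<union> {x. \<not> inj (\<lambda>i. x $ i)}"
  proof
    fix x :: "real^'a::_" assume x: "x \<in> {x \<in> fund_dom. Jac x = 0}"
    show "x \<in> (\<Union>i. {x. x $ i = 0}) \<union> (\<Union>i. {x. x $ i = 1}) \<union> {x. \<not> inj (\<lambda>i. x $ i)}"
    proof (rule ccontr)
      assume n: "\<not> ?thesis"
      have "0 < x $ i \<and> x $ i < 1" for i
      proof -
        have "0 \<le> x $ i" "x $ i \<le> 1" "x $ i \<noteq> 0" "x $ i \<noteq> 1"
          using x n by (auto simp: fund_dom_def)
        then show ?thesis by linarith
      qed
      moreover have "inj (\<lambda>i. x $ i)" using n by simp
      ultimately have "Jac x \<noteq> 0" by (rule Jac_nonzero)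
      then show False using x by simp
    qed
  qed
qed

text \<open>
  The hypothesis \<open>hG\<close> is only required where the Jacobian does not vanish: the integrand \<open>h\<close> may carry
  \<open>Jac\<close> in a denominator, and the exceptional set is negligible.
\<close>

lemma set_integral_frakF:
  fixes h G :: "real^'n::{finite,wellorder} \<Rightarrow> real"
  assumes [measurable]: "h \<in> borel_measurable borel" and G: "continuous_on UNIV G"
    and hG: "\<And>x. x \<in> fund_dom \<Longrightarrow> Jac x \<noteq> 0 \<Longrightarrow> \<bar>Jac x\<bar> * h (phi x) = G x"
  shows "set_integrable lborel frakF h"
    and "(LINT Y:frakF|lborel. h Y) = (LINT x:fund_dom|lborel. G x)"
proof -
  let ?D = "\<lambda>x. \<bar>Jac x\<bar> * h (phi x)"
  have sets: "fund_dom \<in> sets (borel :: (real^'n::_) measure)" "frakF \<in> sets (borel :: (real^'n::_) measure)"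
    using compact_fund_dom compact_continuous_image[OF continuous_on_phi compact_fund_dom]
    by (auto simp: frakF_def intro: borel_compact)
  note [measurable] = sets borel_measurable_continuous_onI[OF G]
  have GS: "set_integrable lborel fund_dom G"
    unfolding set_integrable_def
    by (intro borel_integrable_compact compact_fund_dom continuous_on_subset[OF G]) auto
  then have GL: "G absolutely_integrable_on fund_dom"
    unfolding set_integrable_def by (subst integrable_completion) auto
  have GLI: "(LINT x:fund_dom|lborel. G x) = integral fund_dom G"
    unfolding set_lebesgue_integral_eq_integral(2)[OF GL, symmetric] set_lebesgue_integral_def
    by (rule integral_completion[symmetric]) measurable
  have D: "?D absolutely_integrable_on fund_dom"
    by (rule absolutely_integrable_spike[OF GL negligible_Jac_eq_0]) (use hG in auto)
  have DI: "integral fund_dom ?D = integral fund_dom G"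
    by (rule integral_spike[OF negligible_Jac_eq_0]) (use hG in auto)
  have cov: "(\<lambda>x. \<bar>det (matrix (dphi x))\<bar> *\<^sub>R (vec (h (phi x)) :: real^1)) absolutely_integrable_on fund_dom \<and>
       integral fund_dom (\<lambda>x. \<bar>det (matrix (dphi x))\<bar> *\<^sub>R (vec (h (phi x)) :: real^1)) = vec b
     \<longleftrightarrow> (\<lambda>Y. vec (h Y) :: real^1) absolutely_integrable_on (phi ` fund_dom) \<and>
       integral (phi ` fund_dom) (\<lambda>Y. vec (h Y) :: real^1) = vec b" for b
    using compact_fund_dom
    by (intro has_absolute_integral_change_of_variables phi_has_derivative inj_on_phi)
       (auto intro: lmeasurable_compact fmeasurableD)
  have "h absolutely_integrable_on frakF \<and> integral frakF h = integral fund_dom ?D"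
    using cov[of "integral fund_dom ?D"] D
    unfolding absolutely_integrable_on_1_iff integral_on_1_eq frakF_def Jac_eq
    by (simp add: vec_eq_iff)
  then have hL: "h absolutely_integrable_on frakF" and hI: "integral frakF h = integral fund_dom G"
    by (simp_all add: DI)
  show "set_integrable lborel frakF h"
    using hL unfolding set_integrable_def by (subst (asm) integrable_completion) auto
  have "(LINT Y:frakF|lborel. h Y) = integral frakF h"
    unfolding set_lebesgue_integral_eq_integral(2)[OF hL, symmetric] set_lebesgue_integral_def
    by (rule integral_completion[symmetric]) measurable
  then show "(LINT Y:frakF|lborel. h Y) = (LINT x:fund_dom|lborel. G x)"
    by (simp add: hI GLI)
qed

section \<open>Symmetrization: from ordered points to all points\<close>

definition perm_vec :: "('n \<Rightarrow> 'n) \<Rightarrow> 'a^'n \<Rightarrow> 'a^'n" where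
  "perm_vec \<sigma> x = (\<chi> i. x $ \<sigma> i)"

definition strict_desc :: "'a::linorder^'n::{finite,wellorder} \<Rightarrow> bool" where
  "strict_desc x \<longleftrightarrow> (\<forall>i j. i < j \<longrightarrow> x $ j < x $ i)"

lemma perm_vec_nth [simp]: "perm_vec \<sigma> x $ i = x $ \<sigma> i"
  by (simp add: perm_vec_def)

lemma pos_strict_mono: "i < j \<Longrightarrow> pos i < pos (j :: 'n::{finite,wellorder})"
  unfolding pos_eq by (intro psubset_card_mono) auto

lemma strict_desc_imp_inj: "strict_desc x \<Longrightarrow> inj (($) x)"
proof (rule injI)
  fix i j assume d: "strict_desc x" and e: "x $ i = x $ j"
  then have "\<not> i < j" "\<not> j < i" unfolding strict_desc_def by fastforce+
  then show "i = j" by simp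
qed

text \<open>
  The rank of \<open>i\<close>, the number of entries at least as large as the \<open>i\<close>-th, is a bijection onto
  \<open>{1..n}\<close>, and \<open>\<sigma>\<close> sorts \<open>x\<close> exactly if the rank of \<open>\<sigma> i\<close> is the position of \<open>i\<close>.
\<close>

lemma sorting_permutation_unique:
  fixes x :: "'a::linorder^'n::{finite,wellorder}"
  assumes inj: "inj (($) x)"
  shows "\<exists>!\<sigma>. \<sigma> permutes UNIV \<and> strict_desc (perm_vec \<sigma> x)"
proof -
  define rank where "rank i = card {j. x $ i \<le> x $ j}" for i
  have rank_less: "rank i < rank j" if "x $ j < x $ i" for i j
  proof -
    have "{k. x $ i \<le> x $ k} \<subseteq> {k. x $ j \<le> x $ k}" using that by auto
    moreover have "j \<in> {k. x $ j \<le> x $ k}" "j \<notin> {k. x $ i \<le> x $ k}" using that by auto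
    ultimately show ?thesis unfolding rank_def by (intro psubset_card_mono) auto
  qed
  have inj_rank: "inj rank"
  proof (rule injI)
    fix i j assume "rank i = rank j"
    then have "\<not> x $ j < x $ i" "\<not> x $ i < x $ j" using rank_less[of i j] rank_less[of j i] by auto
    then have "x $ i = x $ j" by simp
    then show "i = j" using inj by (simp add: inj_def)
  qed
  have rank_in: "rank i \<in> {1..CARD('n)}" for i
  proof -
    have "i \<in> {j. x $ i \<le> x $ j}" by simp
    then have "{j. x $ i \<le> x $ j} \<noteq> {}" by blast
    then have "0 < rank i" unfolding rank_def card_gt_0_iff by simp
    moreover have "rank i \<le> CARD('n)" unfolding rank_def by (intro card_mono) auto
    ultimately show ?thesis by simp
  qed
  have "rank ` UNIV = {1..CARD('n)}"
    using inj_rank rank_in by (intro card_subset_eq) (auto simp: card_image)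
  then have bij_rank: "bij_betw rank UNIV {1..CARD('n)}"
    using inj_rank by (simp add: bij_betw_def)
  define \<sigma> :: "'n \<Rightarrow> 'n" where "\<sigma> = inv_into UNIV rank \<circ> pos"
  have rs: "rank (\<sigma> i) = pos i" for i
  proof -
    have "pos i \<in> rank ` UNIV" using bij_rank pos_bounds[of i] by (simp add: bij_betw_def)
    then show ?thesis unfolding \<sigma>_def comp_def by (rule f_inv_into_f)
  qed
  have "bij \<sigma>"
    unfolding \<sigma>_def by (rule bij_betw_trans[OF bij_betw_pos bij_betw_inv_into[OF bij_rank]])
  then have perm: "\<sigma> permutes UNIV" by (simp add: permutes_def bij_iff)
  have desc: "strict_desc (perm_vec \<sigma> x)"
    unfolding strict_desc_def perm_vec_nth
  proof (intro allI impI)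
    fix i j :: 'n assume "i < j"
    then have "rank (\<sigma> i) < rank (\<sigma> j)" unfolding rs by (rule pos_strict_mono)
    moreover from this have "x $ \<sigma> i \<noteq> x $ \<sigma> j" by (auto simp: rank_def)
    moreover have "x $ \<sigma> i < x $ \<sigma> j \<Longrightarrow> rank (\<sigma> j) < rank (\<sigma> i)" by (rule rank_less)
    ultimately have "\<not> x $ \<sigma> i < x $ \<sigma> j" "x $ \<sigma> i \<noteq> x $ \<sigma> j" by linarith+
    then show "x $ \<sigma> j < x $ \<sigma> i" by simp
  qed
  show ?thesis
  proof (rule ex1I[of _ \<sigma>])
    show "\<sigma> permutes UNIV \<and> strict_desc (perm_vec \<sigma> x)" using perm desc by simp
    fix \<tau> assume \<tau>: "\<tau> permutes UNIV \<and> strict_desc (perm_vec \<tau> x)"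
    have "rank (\<tau> i) = pos i" for i
    proof -
      have le: "x $ \<tau> i \<le> x $ \<tau> k \<longleftrightarrow> k \<le> i" for k
      proof -
        have "i < k \<Longrightarrow> x $ \<tau> k < x $ \<tau> i" "k < i \<Longrightarrow> x $ \<tau> i < x $ \<tau> k"
          using \<tau> unfolding strict_desc_def perm_vec_nth by simp_all
        then show ?thesis by (cases i k rule: linorder_cases) auto
      qed
      have "rank (\<tau> i) = card (\<tau> ` {k. x $ \<tau> i \<le> x $ \<tau> k})"
      proof -
        have "{j. x $ \<tau> i \<le> x $ j} = \<tau> ` {k. x $ \<tau> i \<le> x $ \<tau> k}"
        proof (intro equalityI subsetI)
          fix j assume "j \<in> {j. x $ \<tau> i \<le> x $ j}"
          then show "j \<in> \<tau> ` {k. x $ \<tau> i \<le> x $ \<tau> k}"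
            using permutes_inverses(1)[of \<tau> UNIV] \<tau> by (intro image_eqI[of _ _ "inv \<tau> j"]) auto
        qed auto
        then show ?thesis by (simp add: rank_def)
      qed
      also have "\<dots> = card {k. k \<le> i}"
        unfolding le using \<tau> by (intro card_image inj_on_subset[OF permutes_inj]) auto
      finally show ?thesis by (simp add: pos_def)
    qed
    then have "rank (\<tau> i) = rank (\<sigma> i)" for i by (simp add: rs)
    then show "\<tau> = \<sigma>" using inj_rank by (intro ext) (simp add: inj_eq)
  qed
qed

lemma card_sorting_permutations:
  fixes x :: "'a::linorder^'n::{finite,wellorder}"
  assumes "inj (($) x)"
  shows "card {\<sigma>. \<sigma> permutes UNIV \<and> strict_desc (perm_vec \<sigma> x)} = 1"
proof -
  obtain \<sigma> where "{\<sigma>. \<sigma> permutes UNIV \<and> strict_desc (perm_vec \<sigma> x)} = {\<sigma>}"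
    using sorting_permutation_unique[OF assms] by auto
  then show ?thesis by simp
qed

lemma perm_vec_inverse:
  assumes "\<sigma> permutes (UNIV :: 'n::finite set)"
  shows "perm_vec \<sigma> (perm_vec (inv \<sigma>) x) = x" "perm_vec (inv \<sigma>) (perm_vec \<sigma> x) = x"
  using permutes_inverses[OF assms] by (simp_all add: vec_eq_iff)

lemma strict_desc_perm_imp_inj:
  assumes "\<sigma> permutes UNIV" "strict_desc (perm_vec \<sigma> x)"
  shows "inj (($) x)"
proof -
  have "inj (\<lambda>i. perm_vec \<sigma> x $ inv \<sigma> i)"
    using inj_compose[OF strict_desc_imp_inj[OF assms(2)] permutes_inj[OF permutes_inv[OF assms(1)]]]
    by (simp only: comp_def)
  then show ?thesis using permutes_inverses[OF assms(1)] by simp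
qed

text \<open>
  By \<open>card_sorting_permutations\<close>, \<open>h r\<close> equals the sum over all permutations \<open>\<sigma>\<close> of the terms
  \<open>h (perm_vec \<sigma> r)\<close> with \<open>perm_vec \<sigma> r\<close> strictly decreasing; after exchanging the sums, each
  permutation contributes the same amount.
\<close>

lemma sum_strict_desc:
  fixes h :: "int^'n::{finite,wellorder} \<Rightarrow> real" and R :: "int set"
  assumes R: "finite {r :: int^'n::_. \<forall>i. r $ i \<in> R}"
    and sym: "\<And>\<sigma> r. \<sigma> permutes UNIV \<Longrightarrow> h (perm_vec \<sigma> r) = h r"
    and vanish: "\<And>r. \<not> inj (($) r) \<Longrightarrow> h r = 0"
  shows "(\<Sum>r | \<forall>i. r $ i \<in> R. h r) = fact CARD('n) * (\<Sum>r | (\<forall>i. r $ i \<in> R) \<and> strict_desc r. h r)"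
proof -
  let ?B = "{r :: int^'n::_. \<forall>i. r $ i \<in> R}"
  let ?P = "{\<sigma>. \<sigma> permutes (UNIV :: 'n set)}"
  let ?h = "\<lambda>r. if strict_desc r then h r else 0"
  have "h r = (\<Sum>\<sigma>\<in>?P. ?h (perm_vec \<sigma> r))" for r
  proof (cases "inj (($) r)")
    case True
    have "(\<Sum>\<sigma>\<in>?P. ?h (perm_vec \<sigma> r)) = (\<Sum>\<sigma>\<in>?P. if strict_desc (perm_vec \<sigma> r) then h r else 0)"
      by (intro sum.cong refl) (simp add: sym)
    also have "\<dots> = (\<Sum>\<sigma>\<in>{\<sigma>\<in>?P. strict_desc (perm_vec \<sigma> r)}. h r)"
      by (rule sum.inter_filter[symmetric]) (simp add: finite_permutations)
    finally show ?thesis using card_sorting_permutations[OF True] by simp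
  next
    case False
    have "?h (perm_vec \<sigma> r) = 0" if "\<sigma> \<in> ?P" for \<sigma>
      using strict_desc_perm_imp_inj[of \<sigma> r] that False by auto
    then show ?thesis using vanish[OF False] by simp
  qed
  then have "(\<Sum>r\<in>?B. h r) = (\<Sum>r\<in>?B. \<Sum>\<sigma>\<in>?P. ?h (perm_vec \<sigma> r))" by simp
  also have "\<dots> = (\<Sum>\<sigma>\<in>?P. \<Sum>r\<in>?B. ?h (perm_vec \<sigma> r))" by (rule sum.swap)
  also have "\<dots> = (\<Sum>\<sigma>\<in>?P. \<Sum>r\<in>?B. ?h r)"
  proof (rule sum.cong[OF refl])
    fix \<sigma> assume "\<sigma> \<in> ?P"
    then have \<sigma>: "\<sigma> permutes UNIV" by simp
    show "(\<Sum>r\<in>?B. ?h (perm_vec \<sigma> r)) = (\<Sum>r\<in>?B. ?h r)"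
      by (rule sum.reindex_bij_witness[of _ "perm_vec (inv \<sigma>)" "perm_vec \<sigma>"])
         (simp_all add: perm_vec_inverse[OF \<sigma>])
  qed
  also have "(\<Sum>r\<in>?B. ?h r) = (\<Sum>r | (\<forall>i. r $ i \<in> R) \<and> strict_desc r. h r)"
    using sum.inter_filter[OF R, of h strict_desc] by simp
  finally show ?thesis by (simp add: card_permutations[OF refl finite])
qed

lemma perm_vec_measurable [measurable]: "perm_vec \<sigma> \<in> borel_measurable (borel :: (real^'n) measure)"
proof -
  have "continuous_on UNIV (perm_vec \<sigma> :: real^'n \<Rightarrow> real^'n)"
    unfolding perm_vec_def by (intro continuous_intros)
  then show ?thesis by (rule borel_measurable_continuous_onI)
qed

lemma lborel_perm_vec:
  assumes \<sigma>: "\<sigma> permutes (UNIV :: 'n::finite set)"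
  shows "distr lborel borel (perm_vec \<sigma>) = (lborel :: (real^'n) measure)"
proof (rule lborel_eqI[symmetric])
  fix l u :: "real^'n" assume le: "\<And>b. b \<in> Basis \<Longrightarrow> l \<bullet> b \<le> u \<bullet> b"
  then have le': "l $ i \<le> u $ i" for i
    using le[of "axis i 1"] by (simp add: inner_axis axis_in_Basis_iff)
  have vim: "perm_vec \<sigma> -` box l u = box (perm_vec (inv \<sigma>) l) (perm_vec (inv \<sigma>) u)"
  proof (rule set_eqI)
    fix x
    have "(\<forall>i. l $ i < x $ \<sigma> i \<and> x $ \<sigma> i < u $ i) \<longleftrightarrow> (\<forall>i. l $ inv \<sigma> i < x $ i \<and> x $ i < u $ inv \<sigma> i)"
      using permutes_inverses[OF \<sigma>] by metis
    then show "x \<in> perm_vec \<sigma> -` box l u \<longleftrightarrow> x \<in> box (perm_vec (inv \<sigma>) l) (perm_vec (inv \<sigma>) u)"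
      by (simp add: mem_box_cart)
  qed
  have prod_Basis: "(\<Prod>b\<in>Basis. (v :: real^'n) \<bullet> b) = (\<Prod>i\<in>UNIV. v $ i)" for v
  proof -
    have B: "(Basis :: (real^'n) set) = range (\<lambda>i. axis i 1)" by (auto simp: Basis_vec_def)
    show ?thesis unfolding B
      by (subst prod.reindex) (auto simp: inj_on_def axis_eq_axis inner_axis)
  qed
  have "emeasure (distr lborel borel (perm_vec \<sigma>)) (box l u) =
      emeasure lborel (box (perm_vec (inv \<sigma>) l) (perm_vec (inv \<sigma>) u))"
    by (subst emeasure_distr) (simp_all add: vim)
  also have "\<dots> = (\<Prod>b\<in>Basis. (perm_vec (inv \<sigma>) u - perm_vec (inv \<sigma>) l) \<bullet> b)"
    by (rule emeasure_lborel_box) (auto simp: Basis_vec_def inner_axis le')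
  also have "(\<Prod>b\<in>Basis. (perm_vec (inv \<sigma>) u - perm_vec (inv \<sigma>) l) \<bullet> b) = (\<Prod>b\<in>Basis. (u - l) \<bullet> b)"
    unfolding prod_Basis
    using prod.permute[OF permutes_inv[OF \<sigma>], of "\<lambda>i. (u - l) $ i"] by (simp add: o_def)
  finally show "emeasure (distr lborel borel (perm_vec \<sigma>)) (box l u) = (\<Prod>b\<in>Basis. (u - l) \<bullet> b)" .
qed simp

lemma in_fund_dom_iff_strict_desc:
  assumes "inj (($) x)"
  shows "x \<in> fund_dom \<longleftrightarrow> x \<in> cbox 0 1 \<and> strict_desc (x :: real^'n::{finite,wellorder})"
proof -
  have "(\<forall>i j. i \<le> j \<longrightarrow> x $ j \<le> x $ i) \<longleftrightarrow> strict_desc x"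
  proof
    assume d: "\<forall>i j. i \<le> j \<longrightarrow> x $ j \<le> x $ i"
    show "strict_desc x" unfolding strict_desc_def
    proof (intro allI impI)
      fix i j :: 'n assume "i < j"
      then have "x $ j \<le> x $ i" "x $ j \<noteq> x $ i" using d assms by (auto simp: inj_eq)
      then show "x $ j < x $ i" by simp
    qed
  next
    assume "strict_desc x"
    then show "\<forall>i j. i \<le> j \<longrightarrow> x $ j \<le> x $ i"
      unfolding strict_desc_def le_less by auto
  qed
  then show ?thesis by (simp add: fund_dom_def mem_box_cart)
qed

text \<open>
  The same exchange as in \<open>sum_strict_desc\<close>, with the invariance of Lebesgue measure under coordinate
  permutations. Points with coinciding coordinates are handled by a null set, not by vanishing of \<open>G\<close>.
\<close>

lemma integral_cube_fund_dom:
  fixes G :: "real^'n::{finite,wellorder} \<Rightarrow> real"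
  assumes G: "continuous_on UNIV G"
    and sym: "\<And>\<sigma> x. \<sigma> permutes UNIV \<Longrightarrow> G (perm_vec \<sigma> x) = G x"
  shows "(LINT x:cbox 0 1|lborel. G x) = fact CARD('n) * (LINT x:fund_dom|lborel. G x)"
proof -
  let ?P = "{\<sigma>. \<sigma> permutes (UNIV :: 'n set)}"
  define H where "H x = indicator fund_dom x *\<^sub>R G x" for x
  have [measurable]: "fund_dom \<in> sets (borel :: (real^'n::_) measure)"
    by (rule borel_compact[OF compact_fund_dom])
  note [measurable] = borel_measurable_continuous_onI[OF G]
  have Hm [measurable]: "H \<in> borel_measurable borel" unfolding H_def by measurable
  have Hint: "integrable lborel H" unfolding H_def
    by (intro borel_integrable_compact compact_fund_dom continuous_on_subset[OF G]) auto
  have Hperm: "integrable lborel (\<lambda>x. H (perm_vec \<sigma> x))"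
    "(LINT x|lborel. H (perm_vec \<sigma> x)) = (LINT x|lborel. H x)" if "\<sigma> permutes UNIV" for \<sigma>
    using integrable_distr_eq[of "perm_vec \<sigma>" lborel borel H] integral_distr[of "perm_vec \<sigma>" lborel borel H] Hint
    by (simp_all add: lborel_perm_vec[OF that])
  have pointwise: "indicator (cbox 0 1) x *\<^sub>R G x = (\<Sum>\<sigma>\<in>?P. H (perm_vec \<sigma> x))" if inj: "inj (($) x)" for x
  proof -
    have cube: "perm_vec \<sigma> x \<in> cbox 0 1 \<longleftrightarrow> x \<in> cbox 0 1" if "\<sigma> permutes UNIV" for \<sigma>
    proof -
      have "(\<forall>i. 0 \<le> x $ \<sigma> i \<and> x $ \<sigma> i \<le> 1) \<longleftrightarrow> (\<forall>i. 0 \<le> x $ i \<and> x $ i \<le> 1)"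
        using permutes_inverses[OF that] by metis
      then show ?thesis by (simp add: mem_box_cart)
    qed
    have "H (perm_vec \<sigma> x) = (if strict_desc (perm_vec \<sigma> x) then indicator (cbox 0 1) x *\<^sub>R G x else 0)"
      if "\<sigma> \<in> ?P" for \<sigma>
    proof -
      from that have \<sigma>: "\<sigma> permutes UNIV" by simp
      have "(($) (perm_vec \<sigma> x)) = ($) x \<circ> \<sigma>" by (rule ext) simp
      then have "inj (($) (perm_vec \<sigma> x))"
        using inj_compose[OF inj permutes_inj[OF \<sigma>]] by simp
      then have "perm_vec \<sigma> x \<in> fund_dom \<longleftrightarrow> x \<in> cbox 0 1 \<and> strict_desc (perm_vec \<sigma> x)"
        using in_fund_dom_iff_strict_desc cube[OF \<sigma>] by blast
      then show ?thesis by (simp add: H_def sym[OF \<sigma>] indicator_def)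
    qed
    then have "(\<Sum>\<sigma>\<in>?P. H (perm_vec \<sigma> x)) =
        (\<Sum>\<sigma>\<in>?P. if strict_desc (perm_vec \<sigma> x) then indicator (cbox 0 1) x *\<^sub>R G x else 0)"
      by (rule sum.cong[OF refl])
    also have "\<dots> = (\<Sum>\<sigma>\<in>{\<sigma>\<in>?P. strict_desc (perm_vec \<sigma> x)}. indicator (cbox 0 1) x *\<^sub>R G x)"
      by (rule sum.inter_filter[symmetric]) (simp add: finite_permutations)
    finally show ?thesis using card_sorting_permutations[OF inj] by simp
  qed
  have AE: "AE x in lborel. indicator (cbox 0 1) x *\<^sub>R G x = (\<Sum>\<sigma>\<in>?P. H (perm_vec \<sigma> x))"
  proof -
    have "AE x in lebesgue. x \<notin> {x :: real^'n::_. \<not> inj (($) x)}"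
      using negligible_coincident[where 'n = 'n] unfolding negligible_iff_null_sets
      by (rule AE_not_in)
    then have "AE x in lebesgue. indicator (cbox 0 1) x *\<^sub>R G x = (\<Sum>\<sigma>\<in>?P. H (perm_vec \<sigma> x))"
      by eventually_elim (use pointwise in auto)
    then show ?thesis by (simp add: AE_completion_iff)
  qed
  have "(LINT x:cbox 0 1|lborel. G x) = (LINT x|lborel. (\<Sum>\<sigma>\<in>?P. H (perm_vec \<sigma> x)))"
    unfolding set_lebesgue_integral_def by (rule integral_cong_AE[OF _ _ AE]) measurable
  also have "\<dots> = (\<Sum>\<sigma>\<in>?P. (LINT x|lborel. H (perm_vec \<sigma> x)))"
    by (rule Bochner_Integration.integral_sum) (simp add: Hperm)
  also have "\<dots> = (\<Sum>\<sigma>\<in>?P. (LINT x|lborel. H x))"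
    by (rule sum.cong[OF refl]) (simp add: Hperm)
  finally show ?thesis
    by (simp add: card_permutations[OF refl finite] set_lebesgue_integral_def H_def)
qed

section \<open>Trigonometric polynomials and tensor quadrature rules\<close>

text \<open>
  The number \<open>d\<close> bounds the degree in each single \<open>cos (pi x\<^sub>i)\<close>, not the total degree: this is what a
  tensor product of one-dimensional rules is sensitive to. Products of arbitrary polynomials in one
  variable serve as generators since they are closed under multiplication.
\<close>

inductive trig_poly :: "nat \<Rightarrow> (real^'n::finite \<Rightarrow> real) \<Rightarrow> bool" for d where
  product: "(\<And>i. degree (q i) \<le> d) \<Longrightarrow> trig_poly d (\<lambda>x. \<Prod>i\<in>UNIV. poly (q i) (cosv x i))"
| add: "trig_poly d f \<Longrightarrow> trig_poly d g \<Longrightarrow> trig_poly d (\<lambda>x. f x + g x)"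
| scale: "trig_poly d f \<Longrightarrow> trig_poly d (\<lambda>x. a * f x)"

lemma trig_poly_const: "trig_poly d (\<lambda>x. a)"
proof -
  have "trig_poly d (\<lambda>x. a * (\<Prod>i\<in>UNIV. poly ((\<lambda>i. 1) i) (cosv x i)))"
    by (rule trig_poly.scale, rule trig_poly.product) simp
  then show ?thesis by simp
qed

lemma trig_poly_sum: "(\<And>s. s \<in> S \<Longrightarrow> trig_poly d (f s)) \<Longrightarrow> trig_poly d (\<lambda>x. \<Sum>s\<in>S. f s x)"
proof (induction S rule: infinite_finite_induct)
  case (insert s S)
  have "trig_poly d (\<lambda>x. f s x + (\<Sum>s\<in>S. f s x))"
    by (rule trig_poly.add) (use insert in auto)
  then show ?case using insert(1,2) by simp
qed (simp_all add: trig_poly_const)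

lemma trig_poly_mono:
  assumes "trig_poly d f" "d \<le> e"
  shows "trig_poly e f"
  using assms(1)
proof induction
  case (product q)
  show ?case by (rule trig_poly.product) (use product assms(2) le_trans in blast)
qed (auto intro: trig_poly.add trig_poly.scale)

lemma trig_poly_mult:
  assumes "trig_poly d f" "trig_poly e g"
  shows "trig_poly (d + e) (\<lambda>x. f x * g x)"
  using assms(1)
proof induction
  case (product p)
  show ?case
    using assms(2)
  proof induction
    case (product q)
    have "trig_poly (d + e) (\<lambda>x. \<Prod>i\<in>UNIV. poly ((\<lambda>i. p i * q i) i) (cosv x i))"
      by (rule trig_poly.product)
         (rule order.trans[OF degree_mult_le add_mono[OF \<open>\<And>i. degree (p i) \<le> d\<close> product]])
    then show ?case by (simp add: prod.distrib)
  next
    case (add f g)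
    show ?case unfolding distrib_left by (rule trig_poly.add[OF add.IH])
  next
    case (scale f a)
    have "trig_poly (d + e) (\<lambda>x. a * ((\<Prod>i\<in>UNIV. poly (p i) (cosv x i)) * f x))"
      by (rule trig_poly.scale) (rule scale.IH)
    then show ?case by (simp add: mult.left_commute)
  qed
next
  case (add f g)
  show ?case unfolding distrib_right by (rule trig_poly.add[OF add.IH])
next
  case (scale f a)
  have "trig_poly (d + e) (\<lambda>x. a * (f x * g x))"
    by (rule trig_poly.scale) (rule scale.IH)
  then show ?case by (simp add: mult.assoc)
qed

lemma trig_poly_power: "trig_poly d f \<Longrightarrow> trig_poly (m * d) (\<lambda>x. f x ^ m)"
proof (induction m)
  case (Suc m)
  show ?case using trig_poly_mult[OF Suc.prems Suc.IH[OF Suc.prems]] by simp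
qed (simp add: trig_poly_const)

lemma trig_poly_prod:
  assumes "finite S" "\<And>s. s \<in> S \<Longrightarrow> trig_poly (d s) (f s)"
  shows "trig_poly (\<Sum>s\<in>S. d s) (\<lambda>x. \<Prod>s\<in>S. f s x)"
  using assms
proof (induction S rule: finite_induct)
  case (insert s S)
  have "trig_poly (d s + (\<Sum>s\<in>S. d s)) (\<lambda>x. f s x * (\<Prod>s\<in>S. f s x))"
    by (rule trig_poly_mult) (use insert in auto)
  then show ?case using insert(1,2) by simp
qed (simp add: trig_poly_const)

lemma trig_poly_continuous: "trig_poly d f \<Longrightarrow> continuous_on S f"
  by (induction rule: trig_poly.induct) (intro continuous_intros, simp_all add: continuous_on_add continuous_on_mult)

lemma trig_poly_Xfun: "trig_poly 1 (\<lambda>x. phi x $ j)"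
proof -
  have "trig_poly 1 (\<lambda>x. \<Sum>\<sigma> | \<sigma> permutes UNIV.
      \<Prod>i\<in>UNIV. poly ((\<lambda>i. if \<sigma> i \<le> j then [:0, 1:] else 1) i) (cosv x i))"
    by (rule trig_poly_sum, rule trig_poly.product) simp
  moreover have "(\<Sum>\<sigma> | \<sigma> permutes UNIV. \<Prod>i\<in>UNIV. poly ((\<lambda>i. if \<sigma> i \<le> j then [:0, 1:] else 1) i) (cosv x i)) = phi x $ j" for x
    unfolding phi_def Xfun_def cos_plus_def vec_lambda_beta
    by (intro sum.cong refl prod.cong) auto
  ultimately show ?thesis by simp
qed

lemma rpoly_degree_monomial:
  assumes "m \<in> Poly_Mapping.keys f"
  shows "(\<Sum>i\<in>UNIV. Poly_Mapping.lookup m i) \<le> rpoly_degree f"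
  unfolding rpoly_degree_def by (rule Max_ge) (use assms in auto)

text \<open>
  Each \<open>X\<^sub>j\<close> has degree 1 in each variable, so the total degree of a monomial in the \<open>X\<^sub>j\<close> bounds its
  degree in each variable.
\<close>

lemma trig_poly_rpoly: "trig_poly (rpoly_degree f) (\<lambda>x. rpoly_eval f (phi x))"
  unfolding rpoly_eval_def
proof (rule trig_poly_sum, rule trig_poly.scale, rule trig_poly_mono)
  fix m assume m: "m \<in> Poly_Mapping.keys f"
  show "trig_poly (\<Sum>i\<in>UNIV. Poly_Mapping.lookup m i * 1) (\<lambda>x. \<Prod>i\<in>UNIV. (phi x $ i) ^ Poly_Mapping.lookup m i)"
    by (rule trig_poly_prod[OF finite], rule trig_poly_power, rule trig_poly_Xfun)
  show "(\<Sum>i\<in>UNIV. Poly_Mapping.lookup m i * 1) \<le> rpoly_degree f"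
    using rpoly_degree_monomial[OF m] by simp
qed

lemma trig_poly_cos_minus:
  "trig_poly (2 * CARD('n) - 1) (\<lambda>x :: real^'n::{finite,wellorder}. (cos_minus rho2 x)\<^sup>2)"
proof -
  have "\<forall>(a::'n) (b::'n). \<exists>q. degree q \<le> 2 * CARD('n) - 1 \<and>
     (\<forall>t. cos (pi * rho2 $ a * t) * cos (pi * rho2 $ b * t) = poly q (cos (pi * t)))"
  proof (intro allI)
    fix a b :: 'n
    show "\<exists>q. degree q \<le> 2 * CARD('n) - 1 \<and>
      (\<forall>t. cos (pi * rho2 $ a * t) * cos (pi * rho2 $ b * t) = poly q (cos (pi * t)))"
      by (rule cos_rho2_mult_poly[of a b], rule exI, rule conjI, assumption, simp)
  qed
  then obtain q where q: "\<And>(a::'n) (b::'n). degree (q a b) \<le> 2 * CARD('n) - 1"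
     "\<And>a b t. cos (pi * rho2 $ a * t) * cos (pi * rho2 $ b * t) = poly (q a b) (cos (pi * t))"
    by metis
  let ?P = "{\<sigma>. \<sigma> permutes (UNIV :: 'n set)}"
  have "trig_poly (2 * CARD('n) - 1) (\<lambda>x :: real^'n::_. \<Sum>\<sigma>\<in>?P. \<Sum>\<tau>\<in>?P. (of_int (sign \<sigma>) * of_int (sign \<tau>)) *
     (\<Prod>i\<in>UNIV. poly (q (\<sigma> i) (\<tau> i)) (cosv x i)))"
    by (rule trig_poly_sum, rule trig_poly_sum, rule trig_poly.scale, rule trig_poly.product, rule q(1))
  moreover have "(\<Sum>\<sigma>\<in>?P. \<Sum>\<tau>\<in>?P. (of_int (sign \<sigma>) * of_int (sign \<tau>)) *
     (\<Prod>i\<in>UNIV. poly (q (\<sigma> i) (\<tau> i)) (cosv x i))) = (cos_minus rho2 x)\<^sup>2" for x :: "real^'n::_"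
    unfolding cos_minus_def power2_eq_square sum_product
    by (intro sum.cong refl) (simp add: q(2)[symmetric] prod.distrib)
  ultimately show ?thesis by simp
qed

lemma integral_prod_vec:
  fixes f :: "'n::finite \<Rightarrow> real \<Rightarrow> real"
  assumes f: "\<And>i. integrable lborel (f i)"
  shows "(LINT x|(lborel :: (real^'n) measure). (\<Prod>i\<in>UNIV. f i (x $ i))) = (\<Prod>i\<in>UNIV. (LINT t|lborel. f i t))"
proof -
  interpret product_sigma_finite "\<lambda>_ :: real^'n. lborel :: real measure" ..
  let ?T = "\<lambda>y :: real^'n \<Rightarrow> real. \<Sum>b\<in>Basis. y b *\<^sub>R b"
  define g where "g b = f (SOME i. b = axis i 1)" for b :: "real^'n"
  have g: "g (axis i 1) = f i" for i
    unfolding g_def by (simp add: axis_eq_axis)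
  have B: "(Basis :: (real^'n) set) = range (\<lambda>i. axis i 1)" by (auto simp: Basis_vec_def)
  have inj: "inj (\<lambda>i :: 'n. axis i (1 :: real))" by (auto simp: inj_on_def axis_eq_axis)
  have [measurable]: "f i \<in> borel_measurable borel" for i using borel_measurable_integrable[OF f[of i]] by simp
  have "(LINT x|(lborel :: (real^'n) measure). (\<Prod>i\<in>UNIV. f i (x $ i))) =
     (LINT y|(\<Pi>\<^sub>M b\<in>Basis. lborel). (\<Prod>i\<in>UNIV. f i (?T y $ i)))"
  proof (subst lborel_eq, rule integral_distr)
    show "?T \<in> (\<Pi>\<^sub>M b\<in>Basis. lborel) \<rightarrow>\<^sub>M borel" by measurable
    have [measurable]: "(\<lambda>x :: real^'n. x $ i) \<in> borel_measurable borel" for i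
      by (intro borel_measurable_continuous_onI continuous_intros)
    show "(\<lambda>x :: real^'n. \<Prod>i\<in>UNIV. f i (x $ i)) \<in> borel_measurable borel" by measurable
  qed
  also have "\<dots> = (LINT y|(\<Pi>\<^sub>M b\<in>Basis. lborel). (\<Prod>b\<in>Basis. g b (y b)))"
  proof (rule Bochner_Integration.integral_cong[OF refl])
    fix y :: "real^'n \<Rightarrow> real"
    have T: "?T y $ i = y (axis i 1)" for i
    proof -
      have "?T y $ i = ?T y \<bullet> axis i 1" by (simp add: inner_axis)
      also have "\<dots> = y (axis i 1)" by (rule inner_sum_left_Basis) (simp add: B)
      finally show ?thesis .
    qed
    show "(\<Prod>i\<in>UNIV. f i (?T y $ i)) = (\<Prod>b\<in>Basis. g b (y b))"
      unfolding T unfolding B by (subst prod.reindex[OF inj]) (simp add: g)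
  qed
  also have "\<dots> = (\<Prod>b\<in>Basis. (LINT t|lborel. g b t))"
    by (rule product_integral_prod) (auto simp: B g f)
  also have "\<dots> = (\<Prod>i\<in>UNIV. (LINT t|lborel. f i t))"
    unfolding B by (subst prod.reindex[OF inj]) (simp add: g)
  finally show ?thesis .
qed

lemma finite_int_vec_box:
  assumes "finite R"
  shows "finite {r :: int^'n. \<forall>i. r $ i \<in> R}"
proof -
  have "{r :: int^'n. \<forall>i. r $ i \<in> R} \<subseteq> vec_lambda ` (\<Pi>\<^sub>E i\<in>UNIV. R)"
  proof
    fix r :: "int^'n" assume "r \<in> {r. \<forall>i. r $ i \<in> R}"
    then show "r \<in> vec_lambda ` (\<Pi>\<^sub>E i\<in>UNIV. R)"
      by (intro image_eqI[of _ _ "vec_nth r"]) auto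
  qed
  then show ?thesis using finite_PiE[of UNIV "\<lambda>_ :: 'n. R"] assms by (auto intro: finite_subset)
qed

lemma sum_prod_int_vec:
  fixes u :: "'n::finite \<Rightarrow> int \<Rightarrow> real"
  assumes "finite R"
  shows "(\<Sum>r :: int^'n | \<forall>i. r $ i \<in> R. \<Prod>i\<in>UNIV. u i (r $ i)) = (\<Prod>i\<in>UNIV. \<Sum>r\<in>R. u i r)"
proof -
  have "(\<Sum>r :: int^'n | \<forall>i. r $ i \<in> R. \<Prod>i\<in>UNIV. u i (r $ i)) = (\<Sum>g\<in>(\<Pi>\<^sub>E i\<in>UNIV. R). \<Prod>i\<in>UNIV. u i (g i))"
    by (rule sum.reindex_bij_witness[of _ vec_lambda vec_nth]) auto
  also have "\<dots> = (\<Prod>i\<in>UNIV. \<Sum>r\<in>R. u i r)"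
    by (rule prod_sum_PiE[symmetric]) (use assms in auto)
  finally show ?thesis .
qed

definition exact_rule :: "nat \<Rightarrow> int set \<Rightarrow> (int \<Rightarrow> real) \<Rightarrow> (int \<Rightarrow> real) \<Rightarrow> bool" where
  "exact_rule D R w s \<longleftrightarrow> finite R \<and> (\<forall>q. degree q \<le> D \<longrightarrow>
     (\<Sum>r\<in>R. w r * poly q (cos (pi * s r))) = (LINT t:{0..1}|lborel. poly q (cos (pi * t))))"

lemma set_integrable_cube:
  fixes f :: "real^'n \<Rightarrow> real"
  assumes "continuous_on UNIV f"
  shows "set_integrable lborel (cbox 0 1) f"
  unfolding set_integrable_def
  by (intro borel_integrable_compact compact_cbox continuous_on_subset[OF assms]) auto

lemma tensor_rule_exact:
  assumes "exact_rule D R w s" "trig_poly D (g :: real^'n \<Rightarrow> real)"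
  shows "(\<Sum>r :: int^'n | \<forall>i. r $ i \<in> R. (\<Prod>i\<in>UNIV. w (r $ i)) * g (\<chi> i. s (r $ i))) = (LINT x:cbox 0 1|lborel. g x)"
  using assms(2)
proof induction
  case (product q)
  have fin: "finite R" using assms(1) by (simp add: exact_rule_def)
  let ?f = "\<lambda>i t. indicator {0..1} t *\<^sub>R poly (q i) (cos (pi * t))"
  have "(\<Sum>r :: int^'n | \<forall>i. r $ i \<in> R. (\<Prod>i\<in>UNIV. w (r $ i)) * (\<Prod>i\<in>UNIV. poly (q i) (cosv (\<chi> i. s (r $ i)) i)))
     = (\<Sum>r :: int^'n | \<forall>i. r $ i \<in> R. \<Prod>i\<in>UNIV. w (r $ i) * poly (q i) (cos (pi * s (r $ i))))"
    by (simp add: prod.distrib)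
  also have "\<dots> = (\<Prod>i\<in>UNIV. \<Sum>r\<in>R. w r * poly (q i) (cos (pi * s r)))"
    by (rule sum_prod_int_vec[OF fin])
  also have "\<dots> = (\<Prod>i\<in>UNIV. (LINT t|lborel. ?f i t))"
    using assms(1) product unfolding exact_rule_def set_lebesgue_integral_def by (intro prod.cong) auto
  also have "\<dots> = (LINT x|(lborel :: (real^'n) measure). (\<Prod>i\<in>UNIV. ?f i (x $ i)))"
    by (intro integral_prod_vec[symmetric] borel_integrable_compact continuous_intros) auto
  also have "\<dots> = (LINT x:cbox 0 1|(lborel :: (real^'n) measure). \<Prod>i\<in>UNIV. poly (q i) (cosv x i))"
    unfolding set_lebesgue_integral_def
  proof (rule Bochner_Integration.integral_cong[OF refl])
    fix x :: "real^'n"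
    show "(\<Prod>i\<in>UNIV. ?f i (x $ i)) = indicator (cbox 0 1) x *\<^sub>R (\<Prod>i\<in>UNIV. poly (q i) (cosv x i))"
    proof (cases "x \<in> cbox 0 1")
      case True
      then show ?thesis by (simp add: mem_box_cart)
    next
      case False
      then obtain i where "x $ i \<notin> {0..1}" by (auto simp: mem_box_cart)
      then have "?f i (x $ i) = 0" by simp
      then have "(\<Prod>i\<in>UNIV. ?f i (x $ i)) = 0" by (intro prod_zero[OF finite] bexI[of _ i] UNIV_I)
      then show ?thesis using False by simp
    qed
  qed
  finally show ?case .
next
  case (add f g)
  have "set_integrable lborel (cbox 0 1) f" "set_integrable lborel (cbox 0 1) g"
    using add.hyps trig_poly_continuous set_integrable_cube by auto
  then have "(LINT x:cbox 0 1|lborel. f x + g x) = (LINT x:cbox 0 1|lborel. f x) + (LINT x:cbox 0 1|lborel. g x)"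
    by (rule set_integral_add(2))
  then show ?case using add.IH by (simp add: distrib_left sum.distrib)
next
  case (scale f a)
  have "(LINT x:cbox 0 1|lborel. a * f x) = a * (LINT x:cbox 0 1|lborel. f x)"
    by (rule set_integral_mult_right)
  then show ?case unfolding scale.IH[symmetric] by (simp add: sum_distrib_left mult_ac)
qed

lemma integral_cos_multiple:
  "(LINT t:{0..1}|lborel. cos (real k * (pi * t))) = (if k = 0 then 1 else 0)"
proof (cases "k = 0")
  case True
  then show ?thesis by (simp add: set_lebesgue_integral_def)
next
  case False
  have "(LINT t|lborel. cos (real k * (pi * t)) * indicator {0..1} t) =
     sin (real k * (pi * 1)) / (real k * pi) - sin (real k * (pi * 0)) / (real k * pi)"
    using False
    by (intro integral_FTC_Icc_real) (auto intro!: derivative_eq_intros continuous_intros)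
  then show ?thesis using False
    by (simp add: set_lebesgue_integral_def mult.commute[of "indicator _ _"] sin_npi)
qed

lemma set_integrable_unit: "continuous_on UNIV f \<Longrightarrow> set_integrable lborel {0..1::real} (f :: real \<Rightarrow> real)"
  unfolding set_integrable_def
  by (intro borel_integrable_compact compact_Icc) (auto intro: continuous_on_subset)

text \<open>
  It suffices to test the rule on \<open>cos (k pi t)\<close>. The proof shows exactness for all products
  \<open>cos (m pi t) * q (cos (pi t))\<close> with \<open>m + degree q \<le> D\<close>, by induction on \<open>q\<close>: a factor \<open>cos (pi t)\<close>
  split off from \<open>q\<close> is absorbed into the frequency by the product formula.
\<close>

lemma exact_ruleI:
  assumes "finite R"
    and cos: "\<And>k. k \<le> D \<Longrightarrow> (\<Sum>r\<in>R. w r * cos (real k * (pi * s r))) = (if k = 0 then 1 else 0)"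
  shows "exact_rule D R w s"
proof -
  define Q where "Q f = (\<Sum>r\<in>R. w r * f (s r))" for f :: "real \<Rightarrow> real"
  define I where "I f = (LINT t:{0..1}|lborel. f t)" for f :: "real \<Rightarrow> real"
  have lin: "Q (\<lambda>t. a * f t + b * g t) = a * Q f + b * Q g"
    "continuous_on UNIV f \<Longrightarrow> continuous_on UNIV g \<Longrightarrow> I (\<lambda>t. a * f t + b * g t) = a * I f + b * I g" for a b f g
    unfolding Q_def I_def
    by (simp_all add: sum_distrib_left sum.distrib distrib_left mult_ac set_integral_add set_integrable_unit)
  have "Q (\<lambda>t. cos (real m * (pi * t)) * poly q (cos (pi * t))) = I (\<lambda>t. cos (real m * (pi * t)) * poly q (cos (pi * t)))"
    if "m + degree q \<le> D" for m q
    using that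
  proof (induction q arbitrary: m)
    case 0
    show ?case by (simp add: Q_def I_def)
  next
    case (pCons b q)
    have base: "Q (\<lambda>t. cos (real m * (pi * t))) = I (\<lambda>t. cos (real m * (pi * t)))"
      using cos[of m] pCons.prems by (simp add: Q_def I_def integral_cos_multiple)
    have cont: "continuous_on UNIV (\<lambda>t. cos (real l * (pi * t)) * poly q (cos (pi * t)))"
      "continuous_on UNIV (\<lambda>t. cos (real l * (pi * t)))" for l
      by (intro continuous_intros)+
    \<comment> \<open>The frequency is \<open>\<bar>m - 1\<bar>\<close>; for \<open>m = 0\<close> both frequencies in the product formula are 1.\<close>
    define l where "l = (if m = 0 then 1 else m - 1)"
    have step: "cos (real m * \<theta>) * cos \<theta> = (1/2) * cos (real (Suc m) * \<theta>) + (1/2) * cos (real l * \<theta>)" for \<theta>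
    proof (cases m)
      case (Suc m')
      have e: "real (Suc m) * \<theta> = real m * \<theta> + \<theta>" "real l * \<theta> = real m * \<theta> - \<theta>"
        by (simp_all add: Suc l_def algebra_simps)
      show ?thesis unfolding e cos_add cos_diff by (simp add: field_simps)
    qed (simp add: l_def)
    show ?case
    proof (cases "q = 0")
      case True
      then show ?thesis using lin[where a = b and f = "\<lambda>t. cos (real m * (pi * t))" and b = 0 and g = "\<lambda>t. cos (real m * (pi * t))"] cont base
        by (simp add: mult.commute)
    next
      case False
      let ?c = "\<lambda>j t. cos (real j * (pi * t)) * poly q (cos (pi * t))"
      have deg: "Suc m + degree q \<le> D" "l + degree q \<le> D"
        using pCons.prems False by (auto simp: l_def)
      let ?h = "\<lambda>t. (1/2) * ?c (Suc m) t + (1/2) * ?c l t"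
      have "Q ?h = (1/2) * Q (?c (Suc m)) + (1/2) * Q (?c l)" by (rule lin(1))
      also have "\<dots> = (1/2) * I (?c (Suc m)) + (1/2) * I (?c l)"
        unfolding pCons.IH[OF deg(1)] pCons.IH[OF deg(2)] ..
      also have "\<dots> = I ?h" by (rule lin(2)[OF cont(1) cont(1), symmetric])
      finally have h: "Q ?h = I ?h" .
      have hc: "continuous_on UNIV ?h" by (intro continuous_intros)
      have "Q (\<lambda>t. b * cos (real m * (pi * t)) + 1 * ?h t) = b * Q (\<lambda>t. cos (real m * (pi * t))) + 1 * Q ?h"
        by (rule lin(1))
      also have "\<dots> = b * I (\<lambda>t. cos (real m * (pi * t))) + 1 * I ?h" unfolding h base ..
      also have "\<dots> = I (\<lambda>t. b * cos (real m * (pi * t)) + 1 * ?h t)"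
        by (rule lin(2)[OF cont(2) hc, symmetric])
      finally have eq: "Q (\<lambda>t. b * cos (real m * (pi * t)) + 1 * ?h t) = I (\<lambda>t. b * cos (real m * (pi * t)) + 1 * ?h t)" .
      have e: "(\<lambda>t. cos (real m * (pi * t)) * poly (pCons b q) (cos (pi * t))) = (\<lambda>t. b * cos (real m * (pi * t)) + 1 * ?h t)"
      proof
        fix t
        have "cos (real m * (pi * t)) * poly (pCons b q) (cos (pi * t)) =
          b * cos (real m * (pi * t)) + (cos (real m * (pi * t)) * cos (pi * t)) * poly q (cos (pi * t))"
          by (simp add: algebra_simps)
        then show "cos (real m * (pi * t)) * poly (pCons b q) (cos (pi * t)) = b * cos (real m * (pi * t)) + 1 * ?h t"
          unfolding step by (simp add: algebra_simps)
      qed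
      show ?thesis unfolding e by (rule eq)
    qed
  qed
  from this[of 0] have "Q (\<lambda>t. poly q (cos (pi * t))) = I (\<lambda>t. poly q (cos (pi * t)))" if "degree q \<le> D" for q
    using that by simp
  then show ?thesis using assms(1) by (simp add: exact_rule_def Q_def I_def)
qed

section \<open>The three one-dimensional rules\<close>

lemma sin_half_mult_cos: "2 * sin (\<theta> / 2) * cos \<alpha> = sin (\<alpha> + \<theta> / 2) - sin (\<alpha> - \<theta> / 2)" for \<theta> :: real
  by (simp add: sin_add sin_diff)

text \<open>
  The Dirichlet kernel; the sum telescopes by \<open>sin_half_mult_cos\<close>.
\<close>

lemma sum_cos_trapezoid:
  "2 * sin (\<theta> / 2) * (1 / 2 + (\<Sum>j<M. cos (real (Suc j) * \<theta>))) = sin (real M * \<theta> + \<theta> / 2)" for \<theta> :: real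
proof (induction M)
  case (Suc M)
  have "2 * sin (\<theta> / 2) * cos (real (Suc M) * \<theta>) = sin (real (Suc M) * \<theta> + \<theta> / 2) - sin (real (Suc M) * \<theta> - \<theta> / 2)"
    by (rule sin_half_mult_cos)
  moreover have "real (Suc M) * \<theta> - \<theta> / 2 = real M * \<theta> + \<theta> / 2" by (simp add: algebra_simps)
  ultimately show ?case using Suc by (simp only: sum.lessThan_Suc distrib_left)
qed simp

lemma sum_cos_midpoint:
  "2 * sin (\<theta> / 2) * (\<Sum>j<M. cos ((real j + 1 / 2) * \<theta>)) = sin (real M * \<theta>)" for \<theta> :: real
proof (induction M)
  case (Suc M)
  have "2 * sin (\<theta> / 2) * cos ((real M + 1 / 2) * \<theta>) =
      sin ((real M + 1 / 2) * \<theta> + \<theta> / 2) - sin ((real M + 1 / 2) * \<theta> - \<theta> / 2)"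
    by (rule sin_half_mult_cos)
  moreover have "(real M + 1 / 2) * \<theta> - \<theta> / 2 = real M * \<theta>" "(real M + 1 / 2) * \<theta> + \<theta> / 2 = real (Suc M) * \<theta>"
    by (simp_all add: algebra_simps)
  ultimately show ?case using Suc by (simp only: sum.lessThan_Suc distrib_left)
qed simp

lemma sin_half_pos: "0 < x \<Longrightarrow> x < 2 \<Longrightarrow> sin (pi * x / 2) > 0"
  by (intro sin_gt_zero) auto

lemma sum_int_less: "(\<Sum>r\<in>{0..int N - 1}. f r) = (\<Sum>j<N. f (int j))"
proof -
  have "{0..int N - 1} = int ` {..<N}"
    by (auto simp: image_iff intro!: bexI[of _ "nat _"])
  then show ?thesis by (simp add: sum.reindex)
qed

lemma sum_cfac:
  assumes "N > 0"
  shows "(\<Sum>r\<in>{0..int N - 1}. cfac N r * g r) = 1 / 2 * g 0 + (\<Sum>j<N - 1. g (int (Suc j)))"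
proof -
  obtain M where N: "N = Suc M" using assms by (cases N) auto
  show ?thesis
    unfolding sum_int_less N sum.lessThan_Suc_shift by (simp add: cfac_def)
qed

text \<open>
  The trapezoidal rule. With \<open>\<theta> = pi k / N\<close> the weighted sum times \<open>2 sin (\<theta> / 2)\<close> contains the factor
  \<open>sin (N \<theta>) = 0\<close>, while \<open>sin (\<theta> / 2) \<noteq> 0\<close> for \<open>0 < k < 2 N\<close>. Here the node 1 is included; it is not
  among the points of \<open>D_minus N\<close>.
\<close>

lemma exact_rule_III:
  assumes "N > 0"
  shows "exact_rule (2 * N - 1) {0..int N} (\<lambda>r. cfac N r / real N) (\<lambda>r. real_of_int r / real N)"
proof (rule exact_ruleI)
  fix k assume k: "k \<le> 2 * N - 1"
  define \<theta> where "\<theta> = pi * (real k / real N)"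
  obtain M where N: "N = Suc M" using assms by (cases N) auto
  let ?S = "1 / 2 + (\<Sum>j<N. cos (real (Suc j) * \<theta>)) - 1 / 2 * cos (real N * \<theta>)"
  have "{0..int N} = insert (int N) {0..int N - 1}" using assms by auto
  then have "(\<Sum>r\<in>{0..int N}. cfac N r * cos (of_int r * \<theta>)) =
      cfac N (int N) * cos (real N * \<theta>) + (\<Sum>r\<in>{0..int N - 1}. cfac N r * cos (of_int r * \<theta>))"
    by simp
  also have "\<dots> = ?S"
    unfolding sum_cfac[OF assms] by (simp add: N cfac_def)
  finally have S: "(\<Sum>r\<in>{0..int N}. cfac N r * cos (of_int r * \<theta>)) = ?S" .
  have "?S = (if k = 0 then real N else 0)"
  proof (cases "k = 0")
    case False
    have N\<theta>: "real N * \<theta> = real k * pi" using assms by (simp add: \<theta>_def)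
    have "2 * sin (\<theta> / 2) * ?S = sin (real N * \<theta> + \<theta> / 2) - sin (\<theta> / 2) * cos (real N * \<theta>)"
      unfolding sum_cos_trapezoid[symmetric] by (simp add: algebra_simps)
    also have "\<dots> = 0" unfolding sin_add N\<theta> by (simp add: sin_npi)
    finally have "2 * sin (\<theta> / 2) * ?S = 0" .
    moreover have "sin (\<theta> / 2) > 0"
    proof -
      have "real k < 2 * real N" using k assms by linarith
      then show ?thesis unfolding \<theta>_def using False assms by (intro sin_half_pos) (auto simp: divide_less_eq)
    qed
    ultimately show ?thesis using False by simp
  qed (simp add: \<theta>_def)
  moreover have "(\<Sum>r\<in>{0..int N}. cfac N r / real N * cos (real k * (pi * (real_of_int r / real N)))) =
     (\<Sum>r\<in>{0..int N}. cfac N r * cos (of_int r * \<theta>)) / real N"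
    unfolding sum_divide_distrib by (rule sum.cong[OF refl]) (simp add: \<theta>_def mult_ac)
  ultimately show "(\<Sum>r\<in>{0..int N}. cfac N r / real N * cos (real k * (pi * (real_of_int r / real N)))) =
      (if k = 0 then 1 else 0)"
    using S assms by simp
qed simp

lemma exact_rule_IV:
  assumes "N > 0"
  shows "exact_rule (2 * N - 1) {0..int N - 1} (\<lambda>r. 1 / real N) (\<lambda>r. (real_of_int r + 1 / 2) / real N)"
proof (rule exact_ruleI)
  fix k assume k: "k \<le> 2 * N - 1"
  define \<theta> where "\<theta> = pi * (real k / real N)"
  let ?S = "\<Sum>j<N. cos ((real j + 1 / 2) * \<theta>)"
  have "?S = (if k = 0 then real N else 0)"
  proof (cases "k = 0")
    case False
    have N\<theta>: "real N * \<theta> = real k * pi" using assms by (simp add: \<theta>_def)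
    have "2 * sin (\<theta> / 2) * ?S = 0" unfolding sum_cos_midpoint N\<theta> by (rule sin_npi)
    moreover have "sin (\<theta> / 2) > 0"
    proof -
      have "real k < 2 * real N" using k assms by linarith
      then show ?thesis unfolding \<theta>_def using False assms by (intro sin_half_pos) (auto simp: divide_less_eq)
    qed
    ultimately show ?thesis using False by simp
  qed (simp add: \<theta>_def)
  moreover have "(\<Sum>r\<in>{0..int N - 1}. 1 / real N * cos (real k * (pi * ((real_of_int r + 1 / 2) / real N)))) = ?S / real N"
    unfolding sum_int_less sum_divide_distrib by (rule sum.cong[OF refl]) (simp add: \<theta>_def mult_ac)
  ultimately show "(\<Sum>r\<in>{0..int N - 1}. 1 / real N * cos (real k * (pi * ((real_of_int r + 1 / 2) / real N)))) =
      (if k = 0 then 1 else 0)"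
    using assms by simp
qed simp

text \<open>
  The even-symmetric form of the rule with \<open>2 N - 1\<close> equidistant points on the circle; exactness first
  fails at the frequency \<open>2 N - 1\<close>.
\<close>

lemma exact_rule_VII:
  assumes "N > 0"
  shows "exact_rule (2 * N - 2) {0..int N - 1} (\<lambda>r. cfac N r * (2 / (2 * real N - 1)))
     (\<lambda>r. 2 * real_of_int r / (2 * real N - 1))"
proof (rule exact_ruleI)
  fix k assume k: "k \<le> 2 * N - 2"
  define L where "L = 2 * real N - 1"
  have L: "L > 0" using assms by (simp add: L_def)
  define \<theta> where "\<theta> = pi * (2 * real k / L)"
  let ?S = "1 / 2 + (\<Sum>j<N - 1. cos (real (Suc j) * \<theta>))"
  have S: "(\<Sum>r\<in>{0..int N - 1}. cfac N r * cos (of_int r * \<theta>)) = ?S"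
    unfolding sum_cfac[OF assms] by simp
  have "?S = (if k = 0 then L / 2 else 0)"
  proof (cases "k = 0")
    case True
    then show ?thesis using assms by (simp add: \<theta>_def L_def of_nat_diff field_simps)
  next
    case False
    have N\<theta>: "real (N - 1) * \<theta> + \<theta> / 2 = real k * pi"
    proof -
      have "real (N - 1) * \<theta> + \<theta> / 2 = L * \<theta> / 2" using assms by (simp add: L_def of_nat_diff field_simps)
      also have "\<dots> = real k * pi" using L by (simp add: \<theta>_def)
      finally show ?thesis .
    qed
    have "2 * sin (\<theta> / 2) * ?S = 0" unfolding sum_cos_trapezoid N\<theta> by (rule sin_npi)
    moreover have "sin (\<theta> / 2) > 0"
    proof -
      have "real k < L" using k assms unfolding L_def by linarith
      then show ?thesis unfolding \<theta>_def using False L by (intro sin_half_pos) (auto simp: divide_less_eq)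
    qed
    ultimately show ?thesis using False by simp
  qed
  moreover have "(\<Sum>r\<in>{0..int N - 1}. cfac N r * (2 / L) * cos (real k * (pi * (2 * real_of_int r / L)))) =
     (2 / L) * (\<Sum>r\<in>{0..int N - 1}. cfac N r * cos (of_int r * \<theta>))"
    unfolding sum_distrib_left by (rule sum.cong[OF refl]) (simp add: \<theta>_def mult_ac)
  ultimately show "(\<Sum>r\<in>{0..int N - 1}. cfac N r * (2 / (2 * real N - 1)) *
      cos (real k * (pi * (2 * real_of_int r / (2 * real N - 1))))) = (if k = 0 then 1 else 0)"
    using S L unfolding L_def[symmetric] by simp
qed simp


section \<open>Cubature on the ordered grid\<close>

lemma cos_minus_perm:
  assumes "\<sigma> permutes (UNIV :: 'n::finite set)"
  shows "cos_minus l (perm_vec \<sigma> x) = of_int (sign \<sigma>) * cos_minus l (x :: real^'n)"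
  using det_permute_rows[OF assms, of "\<chi> i j. cos (pi * l $ j * x $ i)"]
  by (simp add: cos_minus_det)

lemma cos_minus_eq_0_not_inj:
  assumes "\<not> inj (($) (x :: real^'n::finite))"
  shows "cos_minus l x = 0"
proof -
  obtain i j where ij: "i \<noteq> j" "x $ i = x $ j" using assms by (auto simp: inj_def)
  show ?thesis unfolding cos_minus_det
    by (rule det_identical_rows[OF ij(1)]) (simp add: row_def ij(2))
qed

text \<open>
  All entries of \<open>rho2\<close> are half-integers, so the row of the determinant for such a coordinate is
  zero.
\<close>

lemma cos_minus_rho2_eq_0:
  assumes "x $ (i :: 'n::{finite,wellorder}) = 1"
  shows "cos_minus rho2 x = 0"
  unfolding cos_minus_det
proof (rule det_zero_row(1))
  have "cos (pi * rho2 $ j * x $ i) = 0" for j :: 'n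
  proof -
    have "cos (pi * rho2 $ j * x $ i) = cos (real (CARD('n) - pos j) * pi + pi / 2)"
      by (simp add: assms rho2_nth algebra_simps)
    also have "\<dots> = 0" unfolding cos_add by (simp add: sin_npi)
    finally show ?thesis .
  qed
  then show "row i (\<chi> i j. cos (pi * rho2 $ j * x $ i)) = (0 :: real^'n::_)"
    by (simp add: row_def vec_eq_iff)
qed

lemma phi_perm:
  assumes \<sigma>: "\<sigma> permutes (UNIV :: 'n::{finite,wellorder} set)"
  shows "phi (perm_vec \<sigma> x) = phi (x :: real^'n::_)"
proof -
  have "elem_sym m UNIV (cosv (perm_vec \<sigma> x)) = elem_sym m UNIV (cosv x)" for m
  proof -
    have "(\<Sum>S | S \<subseteq> UNIV \<and> card S = m. \<Prod>i\<in>S. cosv x (\<sigma> i)) = (\<Sum>S | S \<subseteq> UNIV \<and> card S = m. \<Prod>i\<in>S. cosv x i)"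
    proof (rule sum.reindex_bij_witness[of _ "\<lambda>S. inv \<sigma> ` S" "\<lambda>S. \<sigma> ` S"])
      fix S :: "'n set"
      show "inv \<sigma> ` \<sigma> ` S = S" "\<sigma> ` inv \<sigma> ` S = S"
        by (simp_all add: image_image permutes_inverses[OF \<sigma>])
      have "inj \<sigma>" "inj (inv \<sigma>)" using \<sigma> permutes_inv[OF \<sigma>] by (auto dest: permutes_inj)
      then have inj: "inj_on \<sigma> S" "inj_on (inv \<sigma>) S" by (auto intro: inj_on_subset)
      show "S \<in> {S. S \<subseteq> UNIV \<and> card S = m} \<Longrightarrow> inv \<sigma> ` S \<in> {S. S \<subseteq> UNIV \<and> card S = m}"
        "S \<in> {S. S \<subseteq> UNIV \<and> card S = m} \<Longrightarrow> \<sigma> ` S \<in> {S. S \<subseteq> UNIV \<and> card S = m}"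
        by (simp_all add: card_image inj)
      show "(\<Prod>i\<in>\<sigma> ` S. cosv x i) = (\<Prod>i\<in>S. cosv x (\<sigma> i))"
        by (simp add: prod.reindex[OF inj(1)])
    qed
    then show ?thesis by (simp add: elem_sym_def)
  qed
  then show ?thesis by (simp add: phi_def Xfun_elem_sym)
qed

definition pullback :: "'n rpoly \<Rightarrow> real^'n::{finite,wellorder} \<Rightarrow> real" where
  "pullback f x = rpoly_eval f (phi x) * (cos_minus rho2 x)\<^sup>2"

lemma trig_poly_pullback: "trig_poly (rpoly_degree f + (2 * CARD('n) - 1)) (pullback (f :: 'n::{finite,wellorder} rpoly))"
  using trig_poly_mult[OF trig_poly_rpoly trig_poly_cos_minus] unfolding pullback_def .

lemma pullback_perm: "\<sigma> permutes UNIV \<Longrightarrow> pullback f (perm_vec \<sigma> x) = pullback f x"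
  by (simp add: pullback_def phi_perm cos_minus_perm power_mult_distrib sign_def)

lemma borel_measurable_rpoly_eval [measurable]: "rpoly_eval f \<in> borel_measurable borel"
  unfolding rpoly_eval_def by (intro borel_measurable_continuous_onI continuous_intros)

lemma integral_weighted:
  fixes f :: "'n::{finite,wellorder} rpoly"
  shows "set_integrable lborel frakF (\<lambda>Y. rpoly_eval f Y * omega_III_minus Y)"
    and "(LINT Y:frakF|lborel. rpoly_eval f Y * omega_III_minus Y) = (LINT x:fund_dom|lborel. pullback f x)"
proof -
  have [measurable]: "(\<lambda>Y. rpoly_eval f Y * omega_III_minus Y) \<in> borel_measurable borel"
    unfolding omega_III_minus_def calJ_def by measurable
  have G: "continuous_on UNIV (pullback f)"
    by (rule trig_poly_continuous[OF trig_poly_pullback])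
  have hG: "\<bar>Jac x\<bar> * (rpoly_eval f (phi x) * omega_III_minus (phi x)) = pullback f x" if "Jac x \<noteq> 0" for x
    using that by (simp add: omega_III_minus_def calJ_phi calJ_III_minus_phi pullback_def)
  show "set_integrable lborel frakF (\<lambda>Y. rpoly_eval f Y * omega_III_minus Y)"
    by (rule set_integral_frakF(1)[OF _ G hG]) measurable
  show "(LINT Y:frakF|lborel. rpoly_eval f Y * omega_III_minus Y) = (LINT x:fund_dom|lborel. pullback f x)"
    by (rule set_integral_frakF(2)[OF _ G hG]) measurable
qed

text \<open>
  Nodes of the rule outside \<open>{0..N - 1}\<close> have to lie at 1, where \<open>cos_minus rho2\<close> vanishes; this
  admits the right end point of the trapezoidal rule.
\<close>

lemma integral_pullback_eq_sum:
  fixes f :: "'n::{finite,wellorder} rpoly"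
  assumes rule: "exact_rule D R w s" and deg: "rpoly_degree f + (2 * CARD('n) - 1) \<le> D"
    and R: "{0..int N - 1} \<subseteq> R" "\<And>r. r \<in> R \<Longrightarrow> r \<notin> {0..int N - 1} \<Longrightarrow> s r = 1"
  shows "(LINT x:fund_dom|lborel. pullback f x) =
    (\<Sum>r\<in>D_minus N. (\<Prod>i\<in>UNIV. w (r $ i)) * pullback f (\<chi> i. s (r $ i)))"
proof -
  define h :: "int^'n::_ \<Rightarrow> real" where "h r = (\<Prod>i\<in>UNIV. w (r $ i)) * pullback f (\<chi> i. s (r $ i))" for r
  have finR: "finite R" using rule by (simp add: exact_rule_def)
  have fin: "finite {r :: int^'n::_. \<forall>i. r $ i \<in> R}" by (rule finite_int_vec_box[OF finR])
  have G: "trig_poly D (pullback f)" by (rule trig_poly_mono[OF trig_poly_pullback deg])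
  have sym: "h (perm_vec \<sigma> r) = h r" if \<sigma>: "\<sigma> permutes UNIV" for \<sigma> r
  proof -
    have "(\<Prod>i\<in>UNIV. w (r $ \<sigma> i)) = (\<Prod>i\<in>UNIV. w (r $ i))"
      using prod.permute[OF \<sigma>, of "\<lambda>i. w (r $ i)"] by (simp add: o_def)
    moreover have "(\<chi> i. s (perm_vec \<sigma> r $ i)) = perm_vec \<sigma> (\<chi> i. s (r $ i))"
      by (simp add: vec_eq_iff)
    ultimately show ?thesis by (simp add: h_def pullback_perm[OF \<sigma>])
  qed
  have vanish: "h r = 0" if "\<not> inj (($) r)" for r
  proof -
    have "\<not> inj (($) (\<chi> i. s (r $ i)))"
    proof
      assume inj: "inj (($) (\<chi> i. s (r $ i)))"
      have "inj (($) r)"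
      proof (rule injI)
        fix i j assume "r $ i = r $ j"
        then have "(\<chi> i. s (r $ i)) $ i = (\<chi> i. s (r $ i)) $ j" by simp
        then show "i = j" by (rule injD[OF inj])
      qed
      with that show False ..
    qed
    then show ?thesis by (simp add: h_def pullback_def cos_minus_eq_0_not_inj)
  qed
  have "fact CARD('n) * (LINT x:fund_dom|lborel. pullback f x) = (LINT x:cbox 0 1|lborel. pullback f x)"
    by (rule integral_cube_fund_dom[symmetric, OF trig_poly_continuous[OF G] pullback_perm])
  also have "\<dots> = (\<Sum>r | \<forall>i. r $ i \<in> R. h r)"
    unfolding h_def by (rule tensor_rule_exact[OF rule G, symmetric])
  also have "\<dots> = fact CARD('n) * (\<Sum>r | (\<forall>i. r $ i \<in> R) \<and> strict_desc r. h r)"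
    by (rule sum_strict_desc[OF fin sym vanish])
  finally have "(LINT x:fund_dom|lborel. pullback f x) = (\<Sum>r | (\<forall>i. r $ i \<in> R) \<and> strict_desc r. h r)"
    by simp
  also have "\<dots> = (\<Sum>r\<in>D_minus N. h r)"
  proof (rule sum.mono_neutral_right)
    show "finite {r :: int^'n::_. (\<forall>i. r $ i \<in> R) \<and> strict_desc r}"
      by (rule finite_subset[OF _ fin]) auto
    have "r $ i \<in> R" if "0 \<le> r $ i \<and> r $ i \<le> int N - 1" for i and r :: "int^'n::_"
      using R(1) that by auto
    then show "D_minus N \<subseteq> {r :: int^'n::_. (\<forall>i. r $ i \<in> R) \<and> strict_desc r}"
      unfolding D_minus_def strict_desc_def by blast
    show "\<forall>r\<in>{r. (\<forall>i. r $ i \<in> R) \<and> strict_desc r} - D_minus N. h r = 0"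
    proof
      fix r :: "int^'n::_" assume r: "r \<in> {r. (\<forall>i. r $ i \<in> R) \<and> strict_desc r} - D_minus N"
      then obtain i where i: "r $ i \<notin> {0..int N - 1}" "r $ i \<in> R"
        unfolding D_minus_def strict_desc_def by auto
      then have "(\<chi> i. s (r $ i)) $ i = 1" using R(2) by simp
      then have "cos_minus rho2 (\<chi> i. s (r $ i)) = 0" by (rule cos_minus_rho2_eq_0)
      then show "h r = 0" by (simp add: h_def pullback_def)
    qed
  qed
  finally show ?thesis by (simp add: h_def)
qed

text \<open>
  Distinct labels give distinct nodes, so that sums over nodes are sums over labels and the label in
  the definitions of \<open>calE_III\<close> and \<open>calE_VII\<close> is the expected one.
\<close>

lemma inj_on_phi_nodes:
  fixes s :: "int \<Rightarrow> real"
  assumes s: "\<And>r r'. 0 \<le> r \<Longrightarrow> r < r' \<Longrightarrow> r' \<le> int N - 1 \<Longrightarrow> s r < s r'"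
    "\<And>r. 0 \<le> r \<Longrightarrow> r \<le> int N - 1 \<Longrightarrow> 0 \<le> s r \<and> s r \<le> 1"
  shows "inj_on (\<lambda>r. phi (\<chi> i. s (r $ i))) (D_minus N :: (int^'n::{finite,wellorder}) set)"
proof (rule inj_onI)
  fix r q :: "int^'n::_"
  assume r: "r \<in> D_minus N" and q: "q \<in> D_minus N"
    and eq: "phi (\<chi> i. s (r $ i)) = phi (\<chi> i. s (q $ i))"
  have dom: "(\<chi> i. s (p $ i)) \<in> fund_dom" if p: "p \<in> D_minus N" for p :: "int^'n::_"
  proof -
    have b: "0 \<le> p $ i" "p $ i \<le> int N - 1" for i using p by (simp_all add: D_minus_def)
    have "s (p $ j) \<le> s (p $ i)" if "i \<le> j" for i j
    proof (cases "i = j")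
      case False
      then have "p $ j < p $ i" using p that by (simp add: D_minus_def)
      then show ?thesis using s(1)[of "p $ j" "p $ i"] b by fastforce
    qed simp
    then show ?thesis using s(2) b by (simp add: fund_dom_def)
  qed
  have "(\<chi> i. s (r $ i)) = (\<chi> i. s (q $ i))"
    using inj_onD[OF inj_on_phi eq dom[OF r] dom[OF q]] .
  then have e: "s (r $ i) = s (q $ i)" for i by (simp add: vec_eq_iff)
  have "r $ i = q $ i" for i
  proof (rule ccontr)
    assume "r $ i \<noteq> q $ i"
    then consider "r $ i < q $ i" | "q $ i < r $ i" by linarith
    then show False
    proof cases
      case 1
      then have "s (r $ i) < s (q $ i)" using r q by (intro s(1)) (auto simp: D_minus_def)
      then show False using e by simp
    next
      case 2
      then have "s (q $ i) < s (r $ i)" using r q by (intro s(1)) (auto simp: D_minus_def)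
      then show False using e by simp
    qed
  qed
  then show "r = q" by (simp add: vec_eq_iff)
qed

lemma sum_nodes:
  fixes f :: "'n::{finite,wellorder} rpoly" and p :: "int^'n::_ \<Rightarrow> real^'n::_"
  assumes "inj_on (\<lambda>r. phi (p r)) (D_minus N)"
  shows "(\<Sum>Y\<in>phi ` p ` D_minus N. c Y * rpoly_eval f Y * rpoly_eval calJ_III_minus Y) =
    (\<Sum>r\<in>D_minus N. c (phi (p r)) * pullback f (p r))"
  unfolding image_image sum.reindex[OF assms]
  by (simp add: pullback_def calJ_III_minus_phi mult.assoc)

lemma label_unique:
  assumes "inj_on (\<lambda>r. phi (p r)) (D_minus N)" "r \<in> D_minus N"
  shows "(THE q. q \<in> D_minus N \<and> phi (p q) = phi (p r)) = r"
  using assms by (intro the_equality) (auto dest: inj_onD)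

lemma cubature_III:
  fixes f :: "'n::{finite,wellorder} rpoly"
  assumes N: "N > CARD('n)" and deg: "rpoly_degree f \<le> 2 * (N - CARD('n))"
  shows "(LINT x:fund_dom|lborel. pullback f x) = (1 / real N) ^ CARD('n) *
    (\<Sum>Y\<in>frakF_III_minus N. calE_III N Y * rpoly_eval f Y * rpoly_eval calJ_III_minus Y)"
proof -
  have inj: "inj_on (\<lambda>r :: int^'n::_. phi (pt_III N r)) (D_minus N)"
    unfolding pt_III_def using N by (intro inj_on_phi_nodes) (auto simp: divide_strict_right_mono)
  have E: "calE_III N (phi (pt_III N r)) = (\<Prod>i\<in>UNIV. cfac N (r $ i))" if "r \<in> D_minus N" for r :: "int^'n::_"
    unfolding calE_III_def label_unique[OF inj that] Let_def ..
  have d: "rpoly_degree f + (2 * CARD('n) - 1) \<le> 2 * N - 1"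
    using N deg zero_less_card_finite[where 'a = 'n] by linarith
  have "(LINT x:fund_dom|lborel. pullback f x) =
      (\<Sum>r\<in>D_minus N. (\<Prod>i\<in>UNIV. cfac N (r $ i) / real N) * pullback f (pt_III N r))"
    unfolding pt_III_def using N
    by (intro integral_pullback_eq_sum[OF exact_rule_III d]) auto
  also have "\<dots> = (\<Sum>r\<in>D_minus N. (1 / real N) ^ CARD('n) * (calE_III N (phi (pt_III N r)) * pullback f (pt_III N r)))"
    by (rule sum.cong[OF refl]) (simp add: E prod_dividef power_one_over field_simps)
  finally show ?thesis
    unfolding frakF_III_minus_def F_III_minus_def sum_nodes[OF inj] by (simp add: sum_distrib_left)
qed

lemma cubature_IV:
  fixes f :: "'n::{finite,wellorder} rpoly"
  assumes N: "N > CARD('n)" and deg: "rpoly_degree f \<le> 2 * (N - CARD('n))"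
  shows "(LINT x:fund_dom|lborel. pullback f x) = (1 / real N) ^ CARD('n) *
    (\<Sum>Y\<in>frakF_IV_minus N. rpoly_eval f Y * rpoly_eval calJ_III_minus Y)"
proof -
  have range: "(real_of_int r + 1 / 2) / real N \<le> 1" if "r \<le> int N - 1" for r
  proof -
    have "real_of_int r \<le> real N - 1" using that by linarith
    then show ?thesis using N by (simp add: divide_le_eq)
  qed
  have inj: "inj_on (\<lambda>r :: int^'n::_. phi (pt_IV N r)) (D_minus N)"
    unfolding pt_IV_def using N range by (intro inj_on_phi_nodes) (auto simp: divide_strict_right_mono)
  have d: "rpoly_degree f + (2 * CARD('n) - 1) \<le> 2 * N - 1"
    using N deg zero_less_card_finite[where 'a = 'n] by linarith
  have "(LINT x:fund_dom|lborel. pullback f x) =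
      (\<Sum>r\<in>D_minus N. (\<Prod>i\<in>(UNIV :: 'n set). 1 / real N) * pullback f (pt_IV N r))"
    unfolding pt_IV_def using N
    by (intro integral_pullback_eq_sum[OF exact_rule_IV d]) auto
  then show ?thesis
    using sum_nodes[OF inj, of "\<lambda>_. 1" f]
    unfolding frakF_IV_minus_def F_IV_minus_def by (simp add: sum_distrib_left)
qed

lemma cubature_VII:
  fixes f :: "'n::{finite,wellorder} rpoly"
  assumes N: "N > CARD('n)" and deg: "rpoly_degree f \<le> 2 * (N - CARD('n)) - 1"
  shows "(LINT x:fund_dom|lborel. pullback f x) = (2 / (2 * real N - 1)) ^ CARD('n) *
    (\<Sum>Y\<in>frakF_VII_minus N. calE_VII N Y * rpoly_eval f Y * rpoly_eval calJ_III_minus Y)"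
proof -
  have pos: "2 * real N - 1 > 0" using N by simp
  have range: "2 * real_of_int r / (2 * real N - 1) \<le> 1" if "r \<le> int N - 1" for r
  proof -
    have "real_of_int r \<le> real N - 1" using that by linarith
    then show ?thesis using pos by (simp add: divide_le_eq)
  qed
  have inj: "inj_on (\<lambda>r :: int^'n::_. phi (pt_VII N r)) (D_minus N)"
    unfolding pt_VII_def using pos range by (intro inj_on_phi_nodes) (auto simp: divide_strict_right_mono)
  have E: "calE_VII N (phi (pt_VII N r)) = (\<Prod>i\<in>UNIV. cfac N (r $ i))" if "r \<in> D_minus N" for r :: "int^'n::_"
    unfolding calE_VII_def label_unique[OF inj that] Let_def ..
  have d: "rpoly_degree f + (2 * CARD('n) - 1) \<le> 2 * N - 2"
    using N deg zero_less_card_finite[where 'a = 'n] by linarith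
  have "(LINT x:fund_dom|lborel. pullback f x) =
      (\<Sum>r\<in>D_minus N. (\<Prod>i\<in>UNIV. cfac N (r $ i) * (2 / (2 * real N - 1))) * pullback f (pt_VII N r))"
    unfolding pt_VII_def using N
    by (intro integral_pullback_eq_sum[OF exact_rule_VII d]) auto
  also have "\<dots> = (\<Sum>r\<in>D_minus N. (2 / (2 * real N - 1)) ^ CARD('n) *
      (calE_VII N (phi (pt_VII N r)) * pullback f (pt_VII N r)))"
    by (rule sum.cong[OF refl]) (simp only: E prod.distrib prod_constant mult_ac)
  finally show ?thesis
    unfolding frakF_VII_minus_def F_VII_minus_def sum_nodes[OF inj] by (simp add: sum_distrib_left)
qed

theorem mainTheorem15:
  fixes N :: nat
  assumes "N > CARD('n::{finite,wellorder})"
  shows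
    "(\<forall>f :: 'n rpoly. rpoly_degree f \<le> 2 * (N - CARD('n)) \<longrightarrow>
        set_integrable lborel frakF (\<lambda>Y. rpoly_eval f Y * omega_III_minus Y) \<and>
        (LINT Y:frakF|lborel. rpoly_eval f Y * omega_III_minus Y) =
          (1 / real N) ^ CARD('n) *
          (\<Sum>Y\<in>frakF_III_minus N. calE_III N Y * rpoly_eval f Y * rpoly_eval calJ_III_minus Y) \<and>
        (LINT Y:frakF|lborel. rpoly_eval f Y * omega_III_minus Y) =
          (1 / real N) ^ CARD('n) *
          (\<Sum>Y\<in>frakF_IV_minus N. rpoly_eval f Y * rpoly_eval calJ_III_minus Y)) \<and>
     (\<forall>f :: 'n rpoly. rpoly_degree f \<le> 2 * (N - CARD('n)) - 1 \<longrightarrow>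
        set_integrable lborel frakF (\<lambda>Y. rpoly_eval f Y * omega_III_minus Y) \<and>
        (LINT Y:frakF|lborel. rpoly_eval f Y * omega_III_minus Y) =
          (2 / (2 * real N - 1)) ^ CARD('n) *
          (\<Sum>Y\<in>frakF_VII_minus N. calE_VII N Y * rpoly_eval f Y * rpoly_eval calJ_III_minus Y))"
  unfolding integral_weighted(2)
  using integral_weighted(1) cubature_III[OF assms] cubature_IV[OF assms] cubature_VII[OF assms]
  by blast

end
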